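(* Let $\lambda$ be a partition with $d=\ell(\lambda)$ parts and $\mu$ a partition with $[\mu]\subseteq[\lambda]$. Then $$\frac{\mathrm{rpp}_{\lambda/\mu}(q)}{\mathrm{rpp}_\lambda(q)}=\sum_{D\in\mathcal{RE}(\lambda/\mu)}q^{p^*(D)}\prod_{u\in B(D)}\bigl(1-q^{w(u)}\bigr),$$ where $w(i,j)=\lambda_i+d-j$, $p^*(D)=\sum_{u\in F(D)}w(u)$, and $F(D)\subseteq[\lambda^*]\setminus D$ is the set of cells of $[\lambda^*]\setminus D$ that are immediately to the right of a cell of $D$.
   Context: A reverse plane partition of a skew shape $\theta$ is a filling of $[\theta]$ with nonnegative integers, weakly increasing along rows and down columns; $\mathrm{rpp}_\theta(q)=\sum_T q^{|T|}$ over all of them, $|T|$ being the sum of entries. Cells have matrix coordinates $(i,j)$; $\mu_i=0$ for $i>\ell(\mu)$; $\mu'$ is the conjugate of $\mu$; the content of $(i,j)$ is $j-i$. Shifted diagrams: $[\lambda^*]=\{(i,j):1\le i\le d,\ i\le j\le \lambda_i+d-1\}$, $[\mu^*]=\{(i,j):1\le i\le d,\ i\le j\le\mu_i+d-1\}$, and $[\lambda^*/\mu^*]=[\lambda^*]\setminus[\mu^*]$. Reverse excited move: for $D\subseteq[\lambda^*]$ and $(i,j)\in D$ with $(i-1,j-1),(i-1,j)\in[\lambda^*]$ and none of $(i-1,j-1),(i-1,j),(i,j-1)$ in $D$ (the cell $(i,j-1)$ may lie outside $[\lambda^*]$), replace $(i,j)$ by $(i-1,j-1)$. $\mathcal{RE}(\lambda/\mu)$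 is the set of all diagrams obtained from $[\lambda^*/\mu^*]$ by any (possibly empty) sequence of reverse excited moves. Broken diagonals: to each $D\in\mathcal{RE}(\lambda/\mu)$ one associates $\mathsf d_1(D),\dots,\mathsf d_{\mu_1}(D)\subseteq[\lambda^*]\setminus D$. For $D=[\lambda^*/\mu^*]$, $\mathsf d_r$ is the set of cells of $[\mu^*]$ with content $r-\mu'_r+d-1$. If $D'$ is obtained from $D$ by the reverse excited move $(i,j)\to(i-1,j-1)$, then $\mathsf d_r(D')=\mathsf d_r(D)$ for $r\ne t$ and $\mathsf d_t(D')=(\mathsf d_t(D)\setminus\{(i-1,j)\})\cup\{(i,j)\}$, where $t$ is the unique index with $(i-1,j)\in\mathsf d_t(D)$. This is well defined (independent of the sequence of moves). $B(D)=\bigcup_r\mathsf d_r(D)$. *)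

theory Defs
  imports
    "HOL-Computational_Algebra.Formal_Power_Series"
    "HOL-Library.FuncSet"
begin

type_synonym cell = "nat \<times> nat"

definition is_partition :: "nat list \<Rightarrow> bool" where
  "is_partition la \<longleftrightarrow> sorted_wrt (\<ge>) la \<and> (\<forall>x\<in>set la. 0 < x)"

text \<open>Parts are numbered from 1, and \<open>part la i = 0\<close> for \<open>i > length la\<close>.\<close>

definition part :: "nat list \<Rightarrow> nat \<Rightarrow> nat" where
  "part la i = (if 1 \<le> i \<and> i \<le> length la then la ! (i - 1) else 0)"

definition conj_part :: "nat list \<Rightarrow> nat \<Rightarrow> nat" where
  "conj_part la r = card {i. 1 \<le> i \<and> r \<le> part la i \<and> i \<le> length la}"

definition diagram :: "nat list \<Rightarrow> cell set" where
  "diagram la = {(i, j). 1 \<le> i \<and> i \<le> length la \<and> 1 \<le> j \<and> j \<le> part la i}"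

definition content :: "cell \<Rightarrow> int" where
  "content = (\<lambda>(i, j). int j - int i)"


text \<open>Fillings are extensional functions, so that distinct fillings of \<open>\<theta>\<close> are distinct functions.\<close>

definition rpps :: "cell set \<Rightarrow> (cell \<Rightarrow> nat) set" where
  "rpps \<theta> = {T \<in> \<theta> \<rightarrow>\<^sub>E UNIV.
     (\<forall>i j j'. (i, j) \<in> \<theta> \<and> (i, j') \<in> \<theta> \<and> j \<le> j' \<longrightarrow> T (i, j) \<le> T (i, j')) \<and>
     (\<forall>i i' j. (i, j) \<in> \<theta> \<and> (i', j) \<in> \<theta> \<and> i \<le> i' \<longrightarrow> T (i, j) \<le> T (i', j))}"

text \<open>The series \<open>\<Sum>\<^sub>T q\<^bsup>|T|\<^esup>\<close>, collected by powers of \<open>q\<close>; by \<open>finite_rpps_size\<close> below, the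
  coefficients count finite sets when \<open>\<theta>\<close> is finite. The coefficient field is \<open>rat\<close> so that the
  quotient of two such series is the library's division of formal power series.\<close>

definition rpp_gf :: "cell set \<Rightarrow> rat fps" where
  "rpp_gf \<theta> = Abs_fps (\<lambda>n. of_nat (card {T \<in> rpps \<theta>. (\<Sum>u\<in>\<theta>. T u) = n}))"

lemma finite_rpps_size:
  assumes "finite \<theta>"
  shows "finite {T \<in> rpps \<theta>. (\<Sum>u\<in>\<theta>. T u) = n}"
proof (rule finite_subset)
  show "{T \<in> rpps \<theta>. (\<Sum>u\<in>\<theta>. T u) = n} \<subseteq> \<theta> \<rightarrow>\<^sub>E {..n}"
  proof
    fix T assume T: "T \<in> {T \<in> rpps \<theta>. (\<Sum>u\<in>\<theta>. T u) = n}"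
    then have "T u \<le> n" if "u \<in> \<theta>" for u
      using member_le_sum[OF that, of T] assms by simp
    moreover have "T \<in> \<theta> \<rightarrow>\<^sub>E UNIV"
      using T unfolding rpps_def by blast
    ultimately show "T \<in> \<theta> \<rightarrow>\<^sub>E {..n}"
      by (simp add: PiE_iff)
  qed
  show "finite (\<theta> \<rightarrow>\<^sub>E {..n})"
    using assms by (intro finite_PiE) auto
qed


text \<open>The shifted diagram of \<open>la\<close> with \<open>d\<close> rows. Both \<open>[\<lambda>\<^sup>*]\<close> and \<open>[\<mu>\<^sup>*]\<close> use \<open>d = \<ell>(\<lambda>)\<close>.
  No subtraction here, nor in \<open>weight\<close> below on cells of \<open>[\<lambda>\<^sup>*]\<close>, is truncated.\<close>

definition shifted :: "nat \<Rightarrow> nat list \<Rightarrow> cell set" where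
  "shifted d la = {(i, j). 1 \<le> i \<and> i \<le> d \<and> i \<le> j \<and> j \<le> part la i + d - 1}"

definition shifted_skew :: "nat list \<Rightarrow> nat list \<Rightarrow> cell set" where
  "shifted_skew la mu = shifted (length la) la - shifted (length la) mu"

text \<open>The move \<open>(i, j) \<mapsto> (i - 1, j - 1)\<close> in \<open>D\<close> is allowed. Since \<open>(i - 1, j - 1)\<close> must be a cell
  of the shifted diagram \<open>L\<close>, this forces \<open>2 \<le> i\<close> and \<open>2 \<le> j\<close>.\<close>

definition rev_excitable :: "cell set \<Rightarrow> cell set \<Rightarrow> nat \<Rightarrow> nat \<Rightarrow> bool" where
  "rev_excitable L D i j \<longleftrightarrow> (i, j) \<in> D \<and> (i - 1, j - 1) \<in> L \<and> (i - 1, j) \<in> L \<and>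
     (i - 1, j - 1) \<notin> D \<and> (i - 1, j) \<notin> D \<and> (i, j - 1) \<notin> D"

definition rev_move :: "cell set \<Rightarrow> nat \<Rightarrow> nat \<Rightarrow> cell set" where
  "rev_move D i j = insert (i - 1, j - 1) (D - {(i, j)})"

inductive_set RE :: "nat list \<Rightarrow> nat list \<Rightarrow> cell set set" for la mu where
  RE_init: "shifted_skew la mu \<in> RE la mu"
| RE_step: "D \<in> RE la mu \<Longrightarrow> rev_excitable (shifted (length la) la) D i j
    \<Longrightarrow> rev_move D i j \<in> RE la mu"

lemma finite_shifted: "finite (shifted d la)"
proof (rule finite_subset)
  show "shifted d la \<subseteq> (\<Union>i\<in>{..d}. {i} \<times> {..part la i + d})"
    by (auto simp: shifted_def)
qed auto

lemma RE_subset: "D \<in> RE la mu \<Longrightarrow> D \<subseteq> shifted (length la) la"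
  by (induction rule: RE.induct)
    (auto simp: shifted_skew_def rev_excitable_def rev_move_def)

lemma finite_RE: "finite (RE la mu)"
  by (rule finite_subset[of _ "Pow (shifted (length la) la)"])
    (use RE_subset finite_shifted in auto)


definition init_diag :: "nat list \<Rightarrow> nat list \<Rightarrow> nat \<Rightarrow> cell set" where
  "init_diag la mu r = {u \<in> shifted (length la) mu.
     content u = int r - int (conj_part mu r) + int (length la) - 1}"

text \<open>\<open>is_diags la mu D \<delta>\<close> says that some sequence of reverse excited moves leading to \<open>D\<close> produces
  the broken diagonals \<open>\<delta> 1, \<dots>, \<delta> \<mu>\<^sub>1\<close>; outside these indices \<open>\<delta>\<close> is empty, so that
  \<open>\<delta>\<close> is determined by the broken diagonals.\<close>

inductive is_diags :: "nat list \<Rightarrow> nat list \<Rightarrow> cell set \<Rightarrow> (nat \<Rightarrow> cell set) \<Rightarrow> bool" for la mu where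
  diags_init: "is_diags la mu (shifted_skew la mu)
    (\<lambda>r. if r \<in> {1..part mu 1} then init_diag la mu r else {})"
| diags_step: "is_diags la mu D \<delta> \<Longrightarrow> rev_excitable (shifted (length la) la) D i j
    \<Longrightarrow> t \<in> {1..part mu 1} \<Longrightarrow> (i - 1, j) \<in> \<delta> t
    \<Longrightarrow> (\<And>s. s \<in> {1..part mu 1} \<Longrightarrow> (i - 1, j) \<in> \<delta> s \<Longrightarrow> s = t)
    \<Longrightarrow> is_diags la mu (rev_move D i j) (\<delta>(t := insert (i, j) (\<delta> t - {(i - 1, j)})))"

definition broken_diag :: "nat list \<Rightarrow> nat list \<Rightarrow> cell set \<Rightarrow> nat \<Rightarrow> cell set" where
  "broken_diag la mu D = (THE \<delta>. is_diags la mu D \<delta>)"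

definition B :: "nat list \<Rightarrow> nat list \<Rightarrow> cell set \<Rightarrow> cell set" where
  "B la mu D = (\<Union>r\<in>{1..part mu 1}. broken_diag la mu D r)"


definition weight :: "nat list \<Rightarrow> cell \<Rightarrow> nat" where
  "weight la = (\<lambda>(i, j). part la i + length la - j)"

definition F :: "nat list \<Rightarrow> cell set \<Rightarrow> cell set" where
  "F la D = {(i, j). (i, j) \<in> shifted (length la) la - D \<and> (i, j - 1) \<in> D}"

definition pstar :: "nat list \<Rightarrow> cell set \<Rightarrow> nat" where
  "pstar la D = (\<Sum>u\<in>F la D. weight la u)"

end

theory Submission
  imports Defs "HOL-Computational_Algebra.Formal_Laurent_Series"
begin

text \<open>Fix \<open>\<lambda>\<close> and let \<open>R \<nu>\<close> be the generating function of the reverse plane partitions of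
\<open>\<lambda>/\<nu>\<close>. Subtracting one from every entry shows that the fillings with positive entries are
counted by \<open>q ^ |\<lambda>/\<nu>| * R \<nu>\<close>. A filling is positive as soon as it is positive on the corners
that can be added to \<open>\<nu>\<close>, and a zero on a corner may be deleted together with its cell, so
inclusion-exclusion over sets \<open>S\<close> of addable corners gives (\<open>rpp_gf_recurrence\<close>)
\<open>\<Sum>S. (- 1) ^ |S| * R (\<nu> \<union> S) = q ^ |\<lambda>/\<nu>| * R \<nu>\<close>.
For \<open>\<nu> \<noteq> \<lambda>\<close> the coefficient \<open>1 - q ^ |\<lambda>/\<nu>|\<close> of \<open>R \<nu>\<close> is invertible, so all solutions of this
system are multiples of \<open>R\<close>. If \<open>Z \<nu>\<close> denotes the sum over reverse excited diagrams and \<open>Z\<close> solves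
the system too, then \<open>Z \<nu> = R \<nu> * Z \<lambda>\<close>. Since \<open>Z\<close> is \<open>1\<close> at the empty shape,
\<open>Z \<lambda>\<close> is the inverse of the generating function of \<open>\<lambda>\<close>, and the theorem follows
(\<open>pattern_sum_rpp\<close>).

To see that \<open>Z\<close> solves the system, the diagrams are cut into rows. A diagram reached from
\<open>[\<lambda>\<^sup>*/\<mu>\<^sup>*]\<close> is recorded by a chain of shapes \<open>\<mu> = P 0, P 1, \<dots>, P d = \<emptyset>\<close>, where
consecutive shapes interlace and \<open>P k\<close> has first row at most the \<open>(k + 1)\<close>-st part of
\<open>\<lambda>\<close>. Row \<open>k + 1\<close> of the diagram depends only on \<open>\<nu> = P k\<close> and \<open>\<kappa> = P (k + 1)\<close>. With
rows of shapes numbered from \<open>0\<close> and the column measured by \<open>c = j - d\<close>, the cells with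
\<open>\<kappa> i - i \<le> c < \<nu> i - i\<close> lie on broken diagonals, the cells with \<open>c = \<kappa> i - i - 1\<close> lie neither on a
diagonal nor in the diagram (they are called separating below), and the remaining cells are in the
diagram; they form a run before each separating cell, possibly empty, and one run at the end of the row.
A reverse excited move adds one cell to one of the shapes \<open>P k\<close> with \<open>0 < k\<close>, which is why the diagrams
are exactly those of the chains (\<open>RE_eq\<close>) and why the broken diagonals do not depend on the moves (\<open>broken_diag_pattern\<close>).

Hence the weight is a product over rows, and \<open>Z\<close> is obtained from the indicator function of the empty
shape by applying one transfer operator for each part of \<open>\<lambda>\<close> (\<open>RE_sum\<close>, \<open>pattern_sum_eq\<close>). The
operator \<open>f \<mapsto> (\<nu> \<mapsto> q ^ |\<nu>| * (\<Sum>S. (- 1) ^ |S| * f (\<nu> \<union> S)))\<close> passes through the transfer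
operator of a part \<open>l\<close> at the price of a factor \<open>q ^ l\<close> (\<open>pieri_transfer\<close>). The factors multiply
to \<open>q ^ |\<lambda>|\<close>, which is the system for \<open>Z\<close> (\<open>pieri_pattern_sum\<close>); its terms with
\<open>\<nu> \<union> S\<close> outside \<open>\<lambda>\<close> vanish (\<open>pattern_sum_vanishes\<close>).

The weights of single cells may involve negative powers of \<open>q\<close> as long as the chain is not known to
stay inside \<open>\<lambda>\<close>. The computation therefore takes place in a field, which is finally
specialised to formal Laurent series.\<close>

section \<open>Inclusion-exclusion for reverse plane partitions\<close>

definition minimal_cells :: "cell set \<Rightarrow> cell set" where
  "minimal_cells \<theta> = {(i, j) \<in> \<theta>. (\<forall>j'. (i, j') \<in> \<theta> \<longrightarrow> j \<le> j') \<and> (\<forall>i'. (i', j) \<in> \<theta> \<longrightarrow> i \<le> i')}"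

lemma alternating_sum_Pow:
  assumes "finite A"
  shows "(\<Sum>S\<in>Pow A. (- 1 :: 'a::field) ^ card S) = of_bool (A = {})"
proof -
  have "(\<Sum>S\<in>Pow A. (- 1 :: 'a) ^ card S) = (\<Sum>S\<in>Pow A. (\<Prod>x\<in>S. - 1) * (\<Prod>x\<in>A - S. 1))"
    by simp
  also have "\<dots> = (\<Prod>x\<in>A. - 1 + 1)" by (rule prod_add[OF assms, symmetric])
  finally show ?thesis using assms by (auto simp: card_gt_0_iff)
qed

text \<open>A minimal cell only bounds other entries from below, and the bound \<open>0\<close> is void. So zeros on minimal
cells can be deleted with their cells, and put back, without affecting the other conditions.\<close>

lemma rpps_minimal_zero:
  assumes fin: "finite \<theta>" and S: "S \<subseteq> minimal_cells \<theta>"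
  shows "card {T \<in> rpps (\<theta> - S). sum T (\<theta> - S) = n} = card {T \<in> rpps \<theta>. sum T \<theta> = n \<and> (\<forall>u\<in>S. T u = 0)}"
proof -
  have S\<theta>: "S \<subseteq> \<theta>" using S by (auto simp: minimal_cells_def)
  have sm: "sum T \<theta> = sum T (\<theta> - S)" if "\<forall>u\<in>S. T u = 0" for T :: "cell \<Rightarrow> nat"
    using that S\<theta> fin by (intro sum.mono_neutral_right) auto
  have row: "j = j'" if "(i, j) \<in> S" "(i, j') \<in> \<theta>" "j' \<le> j" for i j j'
  proof -
    have "(i, j) \<in> minimal_cells \<theta>" using that(1) S by blast
    then have "j \<le> j'" using that(2) by (simp add: minimal_cells_def)
    then show ?thesis using that(3) by simp
  qed
  have col: "i = i'" if "(i, j) \<in> S" "(i', j) \<in> \<theta>" "i' \<le> i" for i j i'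
  proof -
    have "(i, j) \<in> minimal_cells \<theta>" using that(1) S by blast
    then have "i \<le> i'" using that(2) by (simp add: minimal_cells_def)
    then show ?thesis using that(3) by simp
  qed
  let ?A = "{T \<in> rpps (\<theta> - S). sum T (\<theta> - S) = n}"
  let ?B = "{T \<in> rpps \<theta>. sum T \<theta> = n \<and> (\<forall>u\<in>S. T u = 0)}"
  let ?f = "\<lambda>T u. if u \<in> S then 0 else T u :: nat"
  let ?g = "\<lambda>T. restrict T (\<theta> - S)"
  have "bij_betw ?f ?A ?B"
  proof (rule bij_betwI[where g = ?g])
    show "?f \<in> ?A \<rightarrow> ?B"
    proof
      fix T assume T: "T \<in> ?A"
      have "sum (?f T) \<theta> = sum (?f T) (\<theta> - S)" by (rule sm) simp
      also have "\<dots> = sum T (\<theta> - S)" by (intro sum.cong) auto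
      also have "\<dots> = n" using T by simp
      finally have "sum (?f T) \<theta> = n" .
      moreover have "?f T \<in> rpps \<theta>"
        unfolding rpps_def
      proof (intro CollectI conjI allI impI)
        show "?f T \<in> \<theta> \<rightarrow>\<^sub>E UNIV" using T S\<theta> by (auto simp: rpps_def PiE_def extensional_def)
      next
        fix i j j' assume a: "(i, j) \<in> \<theta> \<and> (i, j') \<in> \<theta> \<and> j \<le> j'"
        show "?f T (i, j) \<le> ?f T (i, j')"
          using a row[of i j' j] T by (auto simp: rpps_def)
      next
        fix i i' j assume a: "(i, j) \<in> \<theta> \<and> (i', j) \<in> \<theta> \<and> i \<le> i'"
        show "?f T (i, j) \<le> ?f T (i', j)"
          using a col[of i' j i] T by (auto simp: rpps_def)
      qed
      ultimately show "?f T \<in> ?B" by simp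
    qed
    show "?g \<in> ?B \<rightarrow> ?A"
    proof
      fix T assume T: "T \<in> ?B"
      have "sum (?g T) (\<theta> - S) = sum T (\<theta> - S)" by simp
      also have "\<dots> = n" using sm[of T] T by simp
      finally have "sum (?g T) (\<theta> - S) = n" .
      moreover have "?g T \<in> rpps (\<theta> - S)"
        using T by (auto simp: rpps_def)
      ultimately show "?g T \<in> ?A" by simp
    qed
    show "?g (?f T) = T" if "T \<in> ?A" for T
      using that by (auto simp: rpps_def PiE_def extensional_def restrict_def fun_eq_iff)
    show "?f (?g T) = T" if "T \<in> ?B" for T
      using that by (auto simp: rpps_def PiE_def extensional_def restrict_def fun_eq_iff)
  qed
  then show ?thesis by (rule bij_betw_same_card)
qed

text \<open>From a cell that is not minimal there is a step to a strictly smaller cell in its row or column,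
where the entry is at most as large; the descent ends in a minimal cell.\<close>

lemma minimal_positive:
  assumes T: "T \<in> rpps \<theta>" and pos: "\<And>u. u \<in> minimal_cells \<theta> \<Longrightarrow> 0 < T u"
  shows "(i, j) \<in> \<theta> \<Longrightarrow> 0 < T (i, j)"
proof (induction "i + j" arbitrary: i j rule: less_induct)
  case less
  show ?case
  proof (cases "(i, j) \<in> minimal_cells \<theta>")
    case False
    with less.prems consider j' where "(i, j') \<in> \<theta>" "j' < j" | i' where "(i', j) \<in> \<theta>" "i' < i"
      by (auto simp: minimal_cells_def not_le)
    then show ?thesis
    proof cases
      case 1
      then have "0 < T (i, j')" by (intro less.hyps) auto
      moreover have "T (i, j') \<le> T (i, j)" using 1 T less.prems by (auto simp: rpps_def)
      ultimately show ?thesis by simp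
    next
      case 2
      then have "0 < T (i', j)" by (intro less.hyps) auto
      moreover have "T (i', j) \<le> T (i, j)" using 2 T less.prems by (auto simp: rpps_def)
      ultimately show ?thesis by simp
    qed
  qed (use pos in auto)
qed

lemma rpps_positive:
  assumes fin: "finite \<theta>"
  shows "card {T \<in> rpps \<theta>. sum T \<theta> = n \<and> (\<forall>u\<in>\<theta>. 0 < T u)}
    = (if n < card \<theta> then 0 else card {T \<in> rpps \<theta>. sum T \<theta> = n - card \<theta>})"
proof -
  let ?A = "{T \<in> rpps \<theta>. sum T \<theta> = n - card \<theta>}"
  let ?B = "{T \<in> rpps \<theta>. sum T \<theta> = n \<and> (\<forall>u\<in>\<theta>. 0 < T u)}"
  let ?f = "\<lambda>T u. if u \<in> \<theta> then Suc (T u) else T u"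
  let ?g = "\<lambda>T u. if u \<in> \<theta> then T u - 1 else T u"
  have row_sign: "sum (?g T) \<theta> + card \<theta> = sum T \<theta>" if "\<forall>u\<in>\<theta>. 0 < T u" for T :: "cell \<Rightarrow> nat"
  proof -
    have "sum (?g T) \<theta> + card \<theta> = (\<Sum>u\<in>\<theta>. ?g T u + 1)" by (simp only: sum.distrib card_eq_sum)
    also have "\<dots> = sum T \<theta>" using that by (intro sum.cong) auto
    finally show ?thesis .
  qed
  show ?thesis
  proof (cases "n < card \<theta>")
    case True
    then have "?B = {}" using row_sign by fastforce
    then show ?thesis using True by (simp only: card.empty if_True)
  next
    case False
    have "bij_betw ?f ?A ?B"
    proof (rule bij_betwI[where g = ?g])
      show "?f \<in> ?A \<rightarrow> ?B"
      proof
        fix T assume T: "T \<in> ?A"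
        have "sum (?f T) \<theta> = (\<Sum>u\<in>\<theta>. T u + 1)" by (intro sum.cong) auto
        also have "\<dots> = sum T \<theta> + card \<theta>" by (simp only: sum.distrib card_eq_sum)
        also have "\<dots> = n" using T False by simp
        finally have "sum (?f T) \<theta> = n" .
        moreover have "?f T \<in> rpps \<theta>" using T by (auto simp: rpps_def PiE_def extensional_def)
        ultimately show "?f T \<in> ?B" by simp
      qed
      show "?g \<in> ?B \<rightarrow> ?A"
      proof
        fix T assume T: "T \<in> ?B"
        have "sum (?g T) \<theta> = n - card \<theta>" using row_sign[of T] T by auto
        moreover have "?g T \<in> rpps \<theta>" using T by (auto simp: rpps_def PiE_def extensional_def intro: diff_le_mono)
        ultimately show "?g T \<in> ?A" by simp
      qed
    qed (auto simp: fun_eq_iff)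
    then show ?thesis using False bij_betw_same_card by fastforce
  qed
qed

text \<open>Inclusion-exclusion over the minimal cells carrying a zero: the alternating sum counts the fillings
with no zero on a minimal cell, hence with no zero at all, and these are the fillings raised by one.\<close>

theorem rpp_gf_recurrence:
  assumes fin: "finite \<theta>"
  shows "(\<Sum>S\<in>Pow (minimal_cells \<theta>). (- 1) ^ card S * rpp_gf (\<theta> - S)) = fps_X ^ card \<theta> * rpp_gf \<theta>"
proof (rule fps_ext)
  fix n
  let ?M = "minimal_cells \<theta>" and ?X = "{T \<in> rpps \<theta>. sum T \<theta> = n}"
  let ?Z = "\<lambda>T :: cell \<Rightarrow> nat. {u. T u = 0}"
  have M\<theta>: "?M \<subseteq> \<theta>" by (auto simp: minimal_cells_def)
  then have finM: "finite ?M" using fin finite_subset by blast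
  have finX: "finite ?X" by (rule finite_rpps_size[OF fin])
  have row_sign: "((- 1) ^ k * f) $ n = (- 1) ^ k * f $ n" for k and f :: "rat fps"
    by (cases "even k") auto
  have "(\<Sum>S\<in>Pow ?M. (- 1) ^ card S * rpp_gf (\<theta> - S)) $ n
     = (\<Sum>S\<in>Pow ?M. (- 1) ^ card S * of_nat (card {T \<in> ?X. S \<subseteq> ?Z T}))"
    unfolding fps_sum_nth row_sign
  proof (rule sum.cong[OF refl])
    fix S assume "S \<in> Pow ?M"
    then have S: "S \<subseteq> ?M" by simp
    have "{T \<in> ?X. S \<subseteq> ?Z T} = {T \<in> rpps \<theta>. sum T \<theta> = n \<and> (\<forall>u\<in>S. T u = 0)}" by auto
    then show "(- 1) ^ card S * rpp_gf (\<theta> - S) $ n = (- 1) ^ card S * of_nat (card {T \<in> ?X. S \<subseteq> ?Z T})"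
      using rpps_minimal_zero[OF fin S, of n] by (simp add: rpp_gf_def)
  qed
  also have "\<dots> = (\<Sum>S\<in>Pow ?M. \<Sum>T\<in>?X. (- 1) ^ card S * of_bool (S \<subseteq> ?Z T))"
  proof (rule sum.cong[OF refl])
    fix S
    have "{T \<in> ?X. S \<subseteq> ?Z T} = ?X \<inter> {T. S \<subseteq> ?Z T}" by blast
    then have "of_nat (card {T \<in> ?X. S \<subseteq> ?Z T}) = (\<Sum>T\<in>?X. of_bool (S \<subseteq> ?Z T) :: rat)"
      by (simp only: sum_of_bool_eq[OF finX finX])
    then show "(- 1) ^ card S * of_nat (card {T \<in> ?X. S \<subseteq> ?Z T})
      = (\<Sum>T\<in>?X. (- 1 :: rat) ^ card S * of_bool (S \<subseteq> ?Z T))"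
      by (simp only: sum_distrib_left)
  qed
  also have "\<dots> = (\<Sum>T\<in>?X. \<Sum>S\<in>Pow ?M. (- 1) ^ card S * of_bool (S \<subseteq> ?Z T))"
    by (rule sum.swap)
  also have "\<dots> = (\<Sum>T\<in>?X. of_bool (?M \<inter> ?Z T = {}))"
  proof (rule sum.cong[OF refl])
    fix T
    have "(\<Sum>S\<in>Pow ?M. (- 1) ^ card S * of_bool (S \<subseteq> ?Z T)) = (\<Sum>S\<in>Pow (?M \<inter> ?Z T). (- 1 :: rat) ^ card S)"
      by (rule sum.mono_neutral_cong_right) (use finM in auto)
    also have "\<dots> = of_bool (?M \<inter> ?Z T = {})"
      by (rule alternating_sum_Pow) (use finM in auto)
    finally show "(\<Sum>S\<in>Pow ?M. (- 1 :: rat) ^ card S * of_bool (S \<subseteq> ?Z T)) = of_bool (?M \<inter> ?Z T = {})" .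
  qed
  also have "\<dots> = of_nat (card (?X \<inter> {T. ?M \<inter> ?Z T = {}}))"
    by (simp only: sum_of_bool_eq[OF finX finX])
  also have "?X \<inter> {T. ?M \<inter> ?Z T = {}} = {T \<in> rpps \<theta>. sum T \<theta> = n \<and> (\<forall>u\<in>\<theta>. 0 < T u)}"
  proof (intro subset_antisym subsetI)
    fix T assume T: "T \<in> ?X \<inter> {T. ?M \<inter> ?Z T = {}}"
    then have r: "T \<in> rpps \<theta>" by blast
    have p: "0 < T u" if "u \<in> ?M" for u using T that by fastforce
    have "0 < T u" if "u \<in> \<theta>" for u
      using minimal_positive[of T \<theta> "fst u" "snd u", OF r p] that by simp
    then show "T \<in> {T \<in> rpps \<theta>. sum T \<theta> = n \<and> (\<forall>u\<in>\<theta>. 0 < T u)}"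
      using T by simp
  next
    fix T assume "T \<in> {T \<in> rpps \<theta>. sum T \<theta> = n \<and> (\<forall>u\<in>\<theta>. 0 < T u)}"
    then show "T \<in> ?X \<inter> {T. ?M \<inter> ?Z T = {}}" using M\<theta> by force
  qed
  also have "of_nat (card \<dots>) = (fps_X ^ card \<theta> * rpp_gf \<theta>) $ n"
    by (simp add: rpps_positive[OF fin] fps_X_power_mult_nth rpp_gf_def)
  finally show "(\<Sum>S\<in>Pow ?M. (- 1) ^ card S * rpp_gf (\<theta> - S)) $ n = (fps_X ^ card \<theta> * rpp_gf \<theta>) $ n" .
qed

section \<open>Shapes and interlacing\<close>

text \<open>Partitions as functions on row indices counted from \<open>0\<close>, so that no number of rows has to be carried
along and rows can be added freely.\<close>

definition shape :: "(nat \<Rightarrow> nat) \<Rightarrow> bool" where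
  "shape \<nu> \<longleftrightarrow> antimono \<nu> \<and> finite {i. 0 < \<nu> i}"

definition addable :: "(nat \<Rightarrow> nat) \<Rightarrow> nat set" where
  "addable \<nu> = {i. i = 0 \<or> \<nu> i < \<nu> (i - 1)}"

definition add_rows :: "(nat \<Rightarrow> nat) \<Rightarrow> nat set \<Rightarrow> nat \<Rightarrow> nat" where
  "add_rows \<nu> S = (\<lambda>i. \<nu> i + of_bool (i \<in> S))"

text \<open>The shapes \<open>\<kappa>\<close> for which \<open>\<nu>/\<kappa>\<close> is a horizontal strip.\<close>

definition interlaced :: "(nat \<Rightarrow> nat) \<Rightarrow> (nat \<Rightarrow> nat) set" where
  "interlaced \<nu> = {\<kappa>. \<forall>i. \<kappa> i \<le> \<nu> i \<and> \<nu> (Suc i) \<le> \<kappa> i}"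

definition size_of :: "(nat \<Rightarrow> nat) \<Rightarrow> nat" where
  "size_of \<nu> = (\<Sum>i | 0 < \<nu> i. \<nu> i)"

lemma support_subset:
  fixes \<nu> :: "nat \<Rightarrow> nat"
  assumes "\<forall>i\<ge>N. \<nu> i = 0"
  shows "{i. 0 < \<nu> i} \<subseteq> {..<N}"
proof
  fix i assume "i \<in> {i. 0 < \<nu> i}"
  then show "i \<in> {..<N}" using assms[rule_format, of i] by (cases "i < N") auto
qed

lemma shapeE:
  assumes "shape \<nu>"
  obtains M where "\<forall>i\<ge>M. \<nu> i = 0"
proof -
  have "finite {i. 0 < \<nu> i}" using assms by (simp add: shape_def)
  then obtain M where "{i. 0 < \<nu> i} \<subseteq> {..<M}"
    using finite_nat_bounded by blast
  then have "\<nu> i = 0" if "i \<ge> M" for i using that by (auto simp: subset_iff)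
  then show ?thesis using that by blast
qed

lemma shapeI:
  assumes "\<And>i. \<nu> (Suc i) \<le> \<nu> i" "\<forall>i\<ge>M. \<nu> i = 0"
  shows "shape \<nu>"
  unfolding shape_def
proof
  show "antimono \<nu>" using assms(1) by (simp add: antimono_iff_le_Suc)
  have "{i. 0 < \<nu> i} \<subseteq> {..<M}" by (rule support_subset[OF assms(2)])
  then show "finite {i. 0 < \<nu> i}" using finite_subset by blast
qed

lemma shape_antimono: "shape \<nu> \<Longrightarrow> i \<le> j \<Longrightarrow> \<nu> j \<le> \<nu> i"
  by (simp add: shape_def antimonoD)

lemma shape_interlaced:
  assumes "shape \<nu>" "\<kappa> \<in> interlaced \<nu>"
  shows "shape \<kappa>"
proof -
  obtain M where M: "\<forall>i\<ge>M. \<nu> i = 0" using shapeE assms(1) by blast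
  show ?thesis
  proof (rule shapeI[of _ M]; (intro allI impI)?)
    fix i show "\<kappa> (Suc i) \<le> \<kappa> i"
      using assms(2) le_trans[of "\<kappa> (Suc i)" "\<nu> (Suc i)" "\<kappa> i"] by (simp add: interlaced_def)
  next
    fix i assume "i \<ge> M" then show "\<kappa> i = 0"
      using assms(2) M by (simp add: interlaced_def) (metis le_zero_eq)
  qed
qed

lemma size_of_eq: "\<forall>i\<ge>N. \<nu> i = 0 \<Longrightarrow> size_of \<nu> = (\<Sum>i<N. \<nu> i)"
  unfolding size_of_def
  by (rule sum.mono_neutral_left) (simp_all add: support_subset)

text \<open>A finite set of shapes containing everything interlaced with \<open>\<nu>\<close> enlarged by corners. The two sides
of the commutation relation are compared coefficient by coefficient over this set.\<close>

definition near :: "(nat \<Rightarrow> nat) \<Rightarrow> nat \<Rightarrow> (nat \<Rightarrow> nat) set" where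
  "near \<nu> N = {\<kappa>. antimono \<kappa> \<and> (\<forall>i. \<kappa> i \<le> Suc (\<nu> i)) \<and> (\<forall>i\<ge>N. \<kappa> i = 0)}"

lemma finite_near: "finite (near \<nu> N)"
proof (rule finite_subset)
  show "near \<nu> N \<subseteq> {f. \<forall>i. (i \<in> {..<N} \<longrightarrow> f i \<in> {..Suc (Max (\<nu> ` {..<N}))}) \<and> (i \<notin> {..<N} \<longrightarrow> f i = 0)}"
  proof (intro subsetI CollectI allI conjI impI)
    fix \<kappa> i assume k: "\<kappa> \<in> near \<nu> N"
    show "\<kappa> i \<in> {..Suc (Max (\<nu> ` {..<N}))}" if "i \<in> {..<N}"
    proof -
      have "\<nu> i \<le> Max (\<nu> ` {..<N})" using that by auto
      then show ?thesis using k by (auto simp: near_def intro: order_trans)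
    qed
    show "\<kappa> i = 0" if "i \<notin> {..<N}" using that k by (auto simp: near_def)
  qed
  show "finite {f. \<forall>i. (i \<in> {..<N} \<longrightarrow> f i \<in> {..Suc (Max (\<nu> ` {..<N}))}) \<and> (i \<notin> {..<N} \<longrightarrow> f i = (0::nat))}"
    by (rule finite_set_of_finite_funs) auto
qed

lemma interlaced_near:
  assumes "shape \<nu>" "\<forall>i\<ge>N. \<nu> i = 0"
  shows "interlaced \<nu> \<subseteq> near \<nu> N"
proof
  fix \<kappa> assume k: "\<kappa> \<in> interlaced \<nu>"
  then have "antimono \<kappa>" using shape_interlaced[OF assms(1)] by (auto simp: shape_def)
  moreover have "\<kappa> i \<le> \<nu> i" for i using k by (simp add: interlaced_def)
  moreover from this have "\<kappa> i = 0" if "i \<ge> N" for i using assms(2)[rule_format, OF that] by (metis le_zero_eq)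
  ultimately show "\<kappa> \<in> near \<nu> N" by (auto simp: near_def le_SucI)
qed

lemma finite_interlaced: "shape \<nu> \<Longrightarrow> finite (interlaced \<nu>)"
  by (rule shapeE, assumption, rule finite_subset[OF interlaced_near finite_near])

lemma addable_bound:
  assumes "\<forall>i\<ge>M. \<nu> i = (0::nat)"
  shows "addable \<nu> \<subseteq> {..M}"
proof
  fix i assume "i \<in> addable \<nu>"
  moreover have "\<nu> (i - 1) = 0" if "\<not> i \<le> M" using assms[rule_format, of "i - 1"] that by simp
  ultimately show "i \<in> {..M}" by (cases "i \<le> M") (auto simp: addable_def)
qed

lemma shape_add_rows:
  assumes "shape \<nu>" "S \<subseteq> addable \<nu>"
  shows "shape (add_rows \<nu> S)"
proof -
  obtain M where M: "\<forall>i\<ge>M. \<nu> i = 0" using shapeE assms(1) by blast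
  show ?thesis
  proof (rule shapeI[of _ "Suc M"]; (intro allI impI)?)
    fix i show "add_rows \<nu> S (Suc i) \<le> add_rows \<nu> S i"
      using assms shape_antimono[OF assms(1), of i "Suc i"]
      by (cases "Suc i \<in> S") (auto simp: add_rows_def addable_def)
  next
    fix i assume "i \<ge> Suc M" then show "add_rows \<nu> S i = 0"
      using addable_bound[of M \<nu>] assms(2) M by (auto simp: add_rows_def)
  qed
qed

lemma interlaced_add_rows_near:
  assumes "shape \<nu>" "\<forall>i\<ge>M. \<nu> i = 0" "S \<subseteq> addable \<nu>"
  shows "interlaced (add_rows \<nu> S) \<subseteq> near \<nu> (Suc M)"
proof -
  have z: "add_rows \<nu> S i = 0" if "i \<ge> Suc M" for i
    using addable_bound[of M \<nu>] assms that by (auto simp: add_rows_def)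
  show ?thesis
  proof
    fix \<kappa> assume k: "\<kappa> \<in> interlaced (add_rows \<nu> S)"
    then have "\<kappa> \<in> near (add_rows \<nu> S) (Suc M)"
      using interlaced_near[OF shape_add_rows[OF assms(1,3)], of "Suc M"] z by blast
    moreover have "\<kappa> i \<le> Suc (\<nu> i)" for i
    proof -
      have "\<kappa> i \<le> \<nu> i + of_bool (i \<in> S)" using k by (simp add: interlaced_def add_rows_def)
      then show ?thesis by (simp add: of_bool_def split: if_splits)
    qed
    ultimately show "\<kappa> \<in> near \<nu> (Suc M)" by (simp add: near_def)
  qed
qed

section \<open>The weight of one row\<close>

text \<open>The product of \<open>1 - q ^ (l - c)\<close> over the cells of content \<open>c = s - i\<close> in row \<open>i\<close> of a strip. The power is
written as a quotient because \<open>l - c\<close> may be negative. Being zero when row \<open>i\<close> grows instead of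
shrinking, the factor enforces interlacing.\<close>

definition strip :: "'a::field \<Rightarrow> nat \<Rightarrow> nat \<Rightarrow> nat \<Rightarrow> nat \<Rightarrow> 'a" where
  "strip q l i n k = (if k \<le> n then \<Prod>s = k..<n. 1 - q ^ (l + i) / q ^ s else 0)"

text \<open>The factor \<open>q ^ (l - c)\<close> of the cell of content \<open>c = k - i - 1\<close>, which ends the run of diagram
cells between the parts of a strip in rows \<open>i + 1\<close> and \<open>i\<close>; there is no such run when \<open>n = k\<close>. The
value zero enforces the other half of interlacing.\<close>

definition turn :: "'a::field \<Rightarrow> nat \<Rightarrow> nat \<Rightarrow> nat \<Rightarrow> nat \<Rightarrow> 'a" where
  "turn q l i k n =
     (if n < k then q ^ Suc (l + i) / q ^ k else if n = k then 1 else 0)"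

lemma strip_refl [simp]: "strip q l i n n = 1"
  by (simp add: strip_def)

lemma strip_Suc: "k \<le> n \<Longrightarrow>
    strip q l i (Suc n) k = strip q l i n k * (1 - q ^ (l + i) / q ^ n)"
  by (simp add: strip_def prod.atLeastLessThan_Suc)

lemma strip_pred:
  fixes q :: "'a::field"
  assumes "q \<noteq> 0" "Suc k \<le> n"
  shows "strip q l i n k = (1 - q ^ (l + i) / q ^ k) * strip q l i n (Suc k)"
  using assms by (simp add: strip_def prod.atLeast_Suc_lessThan[of k n])

text \<open>The weight of a row belonging to a part \<open>l\<close> of \<open>\<lambda>\<close> in which the shape shrinks from \<open>\<nu>\<close> to \<open>\<kappa>\<close>. Rows of
\<open>\<nu>\<close> that are empty contribute \<open>1\<close>.\<close>

definition branch :: "'a::field \<Rightarrow> nat \<Rightarrow> (nat \<Rightarrow> nat) \<Rightarrow> (nat \<Rightarrow> nat) \<Rightarrow> 'a" where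
  "branch q l \<nu> \<kappa> = (\<Prod>i | 0 < \<nu> i. strip q l i (\<nu> i) (\<kappa> i) * turn q l i (\<kappa> i) (\<nu> (Suc i)))"

text \<open>Interlacing is a condition on each row separately, already built into the factors, so the restriction to
interlacing shapes disappears when the product is extended to a fixed range of rows.\<close>

lemma branch_eq:
  assumes "\<forall>i\<ge>N. \<nu> i = 0" "\<forall>i\<ge>N. \<kappa> i = 0"
  shows "(if \<kappa> \<in> interlaced \<nu> then branch q l \<nu> \<kappa> else 0)
    = (\<Prod>i<N. strip q l i (\<nu> i) (\<kappa> i) * turn q l i (\<kappa> i) (\<nu> (Suc i)))"
proof (cases "\<kappa> \<in> interlaced \<nu>")
  case True
  have "branch q l \<nu> \<kappa> = (\<Prod>i<N. strip q l i (\<nu> i) (\<kappa> i) * turn q l i (\<kappa> i) (\<nu> (Suc i)))"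
    unfolding branch_def
  proof (rule prod.mono_neutral_left)
    show "{i. 0 < \<nu> i} \<subseteq> {..<N}" by (rule support_subset[OF assms(1)])
    show "\<forall>i\<in>{..<N} - {i. 0 < \<nu> i}. strip q l i (\<nu> i) (\<kappa> i) * turn q l i (\<kappa> i) (\<nu> (Suc i)) = 1"
    proof
      fix i assume "i \<in> {..<N} - {i. 0 < \<nu> i}"
      then have "\<nu> i = 0" by auto
      moreover have "\<kappa> i \<le> \<nu> i" "\<nu> (Suc i) \<le> \<kappa> i" using True by (simp_all add: interlaced_def)
      ultimately show "strip q l i (\<nu> i) (\<kappa> i) * turn q l i (\<kappa> i) (\<nu> (Suc i)) = 1"
        by (simp add: turn_def)
    qed
  qed simp
  then show ?thesis using True by simp
next
  case False
  then obtain i where i: "\<nu> i < \<kappa> i \<or> \<kappa> i < \<nu> (Suc i)"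
    unfolding interlaced_def by (auto simp: not_le)
  then have "i < N" using assms(1)[rule_format, of "Suc i"] assms(2)[rule_format, of i] by (cases "i < N") auto
  moreover have "strip q l i (\<nu> i) (\<kappa> i) * turn q l i (\<kappa> i) (\<nu> (Suc i)) = 0"
    using i by (auto simp: strip_def turn_def)
  ultimately show ?thesis using False by auto
qed

text \<open>The operator of the recursion satisfied by reverse plane partitions, normalised so that its
eigenvalue on functions coming from \<open>\<lambda>\<close> is \<open>q ^ |\<lambda>|\<close>, independent of \<open>\<nu>\<close>.\<close>

definition pieri :: "'a::field \<Rightarrow> ((nat \<Rightarrow> nat) \<Rightarrow> 'a) \<Rightarrow> (nat \<Rightarrow> nat) \<Rightarrow> 'a" where
  "pieri q f \<nu> = q ^ size_of \<nu> * (\<Sum>S\<in>Pow (addable \<nu>). (- 1) ^ card S * f (add_rows \<nu> S))"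

text \<open>Adds a row with part \<open>l\<close> on top of a configuration whose weight is \<open>f\<close>.\<close>

definition transfer :: "'a::field \<Rightarrow> nat \<Rightarrow> ((nat \<Rightarrow> nat) \<Rightarrow> 'a) \<Rightarrow> (nat \<Rightarrow> nat) \<Rightarrow> 'a" where
  "transfer q l f \<nu> = (\<Sum>\<kappa>\<in>interlaced \<nu>. branch q l \<nu> \<kappa> * f \<kappa>)"

section \<open>The recursion operator passes through a row\<close>

text \<open>A sum over subsets of a product of local choices is a product of two-term sums; this decouples the rows.\<close>

lemma Pow_sum_prod:
  fixes g :: "nat \<Rightarrow> bool \<Rightarrow> 'a::comm_ring_1"
  assumes "finite A"
  shows "(\<Sum>S\<in>Pow A. \<Prod>i\<in>A. g i (i \<in> S)) = (\<Prod>i\<in>A. g i True + g i False)"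
proof -
  have "(\<Prod>i\<in>A. g i True + g i False) = (\<Sum>S\<in>Pow A. (\<Prod>i\<in>S. g i True) * (\<Prod>i\<in>A-S. g i False))"
    by (rule prod_add[OF assms])
  also have "\<dots> = (\<Sum>S\<in>Pow A. \<Prod>i\<in>A. g i (i \<in> S))"
  proof (rule sum.cong[OF refl])
    fix S assume S: "S \<in> Pow A"
    have "(\<Prod>i\<in>A. g i (i \<in> S)) = (\<Prod>i\<in>A-S. g i (i \<in> S)) * (\<Prod>i\<in>S. g i (i \<in> S))"
      using S assms by (intro prod.subset_diff) auto
    then show "(\<Prod>i\<in>S. g i True) * (\<Prod>i\<in>A-S. g i False) = (\<Prod>i\<in>A. g i (i \<in> S))"
      by (simp add: mult.commute)
  qed
  finally show ?thesis by simp
qed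

definition row_sign :: "bool \<Rightarrow> 'a::field" where
  "row_sign e = (if e then - 1 else 1)"

lemma prod_row_sign:
  assumes "S \<subseteq> A" "finite A"
  shows "(\<Prod>i\<in>A. row_sign (i \<in> S)) = (- 1 :: 'a::field) ^ card S"
proof -
  have "(\<Prod>i\<in>A. row_sign (i \<in> S)) = (\<Prod>i\<in>S. - 1 :: 'a)"
    using assms by (intro prod.mono_neutral_cong_right) (auto simp: row_sign_def)
  then show ?thesis by simp
qed

text \<open>The contribution of row \<open>0\<close> to the coefficient of \<open>f \<kappa>\<close> when the recursion operator is applied after the
transfer operator; \<open>e\<close> tells whether a corner is added in this row.\<close>

definition first_row_gain :: "'a::field \<Rightarrow> nat \<Rightarrow> nat \<Rightarrow> nat \<Rightarrow> bool \<Rightarrow> 'a" where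
  "first_row_gain q l n k e = row_sign e * strip q l 0 (n + of_bool e) k"

text \<open>The same for row \<open>i + 1\<close>, where \<open>n0, n\<close> are rows \<open>i, i + 1\<close> of \<open>\<nu>\<close> and \<open>k0, k\<close> are rows \<open>i, i + 1\<close> of
\<open>\<kappa>\<close>. The \<open>turn\<close> factor has been moved here from row \<open>i\<close>, since it depends on row \<open>i + 1\<close> of the enlarged
\<open>\<nu>\<close>. A corner is addable in row \<open>i + 1\<close> exactly when \<open>n < n0\<close>.\<close>

definition outer_gain :: "'a::field \<Rightarrow> nat \<Rightarrow> nat \<Rightarrow> nat \<Rightarrow> nat \<Rightarrow> nat \<Rightarrow> nat \<Rightarrow> bool \<Rightarrow> 'a" where
  "outer_gain q l i n0 k0 n k e =
     (if e \<and> n0 \<le> n then 0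
      else row_sign e * strip q l (Suc i) (n + of_bool e) k * turn q l i k0 (n + of_bool e))"

text \<open>The contribution of row \<open>i\<close> in the opposite order of the operators, with the same arguments. Now \<open>\<kappa>\<close> arises
from a shape interlaced with \<open>\<nu>\<close> by adding corners, and \<open>e\<close> tells whether row \<open>i\<close> received one. The
bound by \<open>k\<close> ensures that the added cells were corners.\<close>

definition inner_gain :: "'a::field \<Rightarrow> nat \<Rightarrow> nat \<Rightarrow> nat \<Rightarrow> nat \<Rightarrow> nat \<Rightarrow> nat \<Rightarrow> bool \<Rightarrow> 'a" where
  "inner_gain q l i n0 k0 n k e =
     (if (e \<and> k0 = 0) \<or> k0 - of_bool e < k then 0
      else row_sign e * q ^ (k0 - of_bool e) * strip q l i n0 (k0 - of_bool e) * turn q l i (k0 - of_bool e) n)"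

text \<open>The part of the contribution of a row that does not depend on neighbouring rows. The second case occurs
for \<open>k = n + 1\<close>, where a corner is necessarily involved and the sign is all that remains.\<close>

definition own_factor :: "'a::field \<Rightarrow> nat \<Rightarrow> nat \<Rightarrow> nat \<Rightarrow> nat \<Rightarrow> 'a" where
  "own_factor q l i n k = (if k \<le> n then strip q l i n k else - 1)"

text \<open>The defect by which the two orders of operators differ in a row with \<open>k = n + 1\<close>. It cancels between
neighbouring rows.\<close>

definition defect :: "'a::field \<Rightarrow> nat \<Rightarrow> nat \<Rightarrow> nat \<Rightarrow> nat \<Rightarrow> 'a" where
  "defect q l i n k = (if k \<le> n then 1 else q ^ Suc (l + i) / q ^ k)"

text \<open>The part of the contribution of rows \<open>i\<close> and \<open>i + 1\<close> coming from their interaction, which up to the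
defects is common to both orders of the operators. It is zero or a monomial, except for a case with \<open>k0 = n + 1\<close> in which
both choices survive and their weights do not combine.\<close>

definition interaction :: "'a::field \<Rightarrow> nat \<Rightarrow> nat \<Rightarrow> nat \<Rightarrow> nat \<Rightarrow> nat \<Rightarrow> nat \<Rightarrow> 'a" where
  "interaction q l i n0 k0 n k =
  (if k0 < n then 0
   else if k \<le> n then
      (if k0 \<le> n0 then
         (if k0 = n then q ^ n
          else if k0 = Suc n then q ^ Suc (l + i) + q ^ (l + i) - q ^ n
          else q ^ Suc (l + i) * q ^ Suc (l + i) / q ^ k0)
       else if k0 = Suc n then q ^ n else q ^ Suc (l + i))
   else if k0 \<le> n0 then
      (if k0 = Suc n then q ^ Suc (l + i) else q ^ Suc (l + i) * q ^ Suc (l + i) / q ^ k0)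
   else if k0 = Suc n then 0 else q ^ Suc (l + i))"

lemma inner_gain_sum:
  fixes q :: "'a::field"
  assumes q: "q \<noteq> 0" and "n \<le> n0" "k \<le> k0" "k0 \<le> Suc n0" "k \<le> Suc n"
  shows "inner_gain q l i n0 k0 n k True + inner_gain q l i n0 k0 n k False
       = own_factor q l i n0 k0 * interaction q l i n0 k0 n k"
proof -
  have sp: "Suc j \<le> n0 \<Longrightarrow> strip q l i n0 j = (1 - q ^ (l + i) / q ^ j) * strip q l i n0 (Suc j)" for j
    using strip_pred[OF q] by simp
  have s0: "strip q l i n0 (Suc n0) = 0"
    by (simp add: strip_def)
  note defs = inner_gain_def row_sign_def own_factor_def interaction_def turn_def power_add
  consider "k0 \<le> n" | "k0 = Suc n" "k0 \<le> n0" | "k0 = Suc n" "n0 = n"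
    | "Suc n < k0" "k0 \<le> n0" | "k0 = Suc n0" "n < n0"
    using assms by linarith
  then show ?thesis
  proof cases
    case 1
    then show ?thesis using assms by (auto simp: defs)
  next
    case 2
    then have e: "strip q l i n0 n = (1 - q ^ (l + i) / q ^ n) * strip q l i n0 (Suc n)" using sp by simp
    from 2 show ?thesis using assms
      by (cases "k \<le> n"; simp add: defs e; simp add: divide_simps; simp add: algebra_simps)
  next
    case 3
    then have "strip q l i n (Suc n) = 0" using s0 by simp
    moreover have "k \<le> n \<or> k = Suc n" using assms by linarith
    ultimately show ?thesis using 3 by (elim disjE; simp add: defs)
  next
    case 4
    then obtain k1 where k1: "k0 = Suc k1" "n < k1" by (cases k0) auto
    with 4 have e: "strip q l i n0 k1 = (1 - q ^ (l + i) / q ^ k1) * strip q l i n0 (Suc k1)" using sp by simp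
    from 4 k1 show ?thesis using assms
      by (cases "k \<le> n"; simp add: defs e; simp add: divide_simps; simp add: algebra_simps)
  next
    case 5
    then show ?thesis using assms s0
      by (cases "k \<le> n"; simp add: defs)
  qed
qed

text \<open>The interaction is the one of \<open>inner_gain_sum\<close>, but it now comes with the own factor of row \<open>i + 1\<close>
instead of row \<open>i\<close>, and the defects of the two rows appear. Interchanging the operators thus shifts
interactions against own factors by one row.\<close>

lemma outer_gain_sum:
  fixes q :: "'a::field"
  assumes q: "q \<noteq> 0" and "n \<le> n0" "k \<le> k0" "k0 \<le> Suc n0" "k \<le> Suc n"
  shows "q ^ n * (outer_gain q l i n0 k0 n k True + outer_gain q l i n0 k0 n k False) * defect q l (Suc i) n k
       = own_factor q l (Suc i) n k * defect q l i n0 k0 * interaction q l i n0 k0 n k"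
proof -
  have sp: "k \<le> n \<Longrightarrow> strip q l (Suc i) (Suc n) k = strip q l (Suc i) n k * (1 - q ^ Suc (l + i) / q ^ n)"
    using strip_Suc[of k n q l "Suc i"] by simp
  have s0: "strip q l (Suc i) n (Suc n) = 0" by (simp add: strip_def)
  note defs = outer_gain_def row_sign_def own_factor_def defect_def interaction_def turn_def power_add
  consider "k0 < n" | "k0 = n" | "k0 = Suc n" "k0 \<le> n0" | "k0 = Suc n" "n0 = n"
    | "Suc n < k0" "k0 \<le> n0" | "k0 = Suc n0" "n < n0"
    using assms by linarith
  note cases_k0 = this
  from assms consider "k \<le> n" | "k = Suc n" by linarith
  then show ?thesis
  proof cases
    case k: 1
    show ?thesis using cases_k0
      by (cases; use assms k in \<open>simp add: defs sp[OF k]; simp add: divide_simps; simp add: algebra_simps\<close>)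
  next
    case k: 2
    show ?thesis using cases_k0
      by (cases; use assms k in \<open>simp add: defs s0; simp add: divide_simps; simp add: algebra_simps\<close>)
  qed
qed

lemma first_row_gain_sum:
  fixes q :: "'a::field"
  assumes q: "q \<noteq> 0" and "k \<le> Suc n"
  shows "q ^ n * (first_row_gain q l n k True + first_row_gain q l n k False) * defect q l 0 n k = q ^ l * own_factor q l 0 n k"
proof -
  have s0: "strip q l 0 n (Suc n) = 0" by (simp add: strip_def)
  from assms consider "k \<le> n" | "k = Suc n" by linarith
  then show ?thesis
  proof cases
    case 1
    then show ?thesis using q
      by (simp add: first_row_gain_def row_sign_def defect_def own_factor_def strip_Suc field_simps)
  next
    case 2
    then show ?thesis using q s0 by (simp add: first_row_gain_def row_sign_def defect_def own_factor_def)
  qed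
qed

text \<open>Row by row the two orders agree up to the quotient of the defects of consecutive rows, so in the product
over an initial segment of rows only the defect of the last row is left. Far down, where both shapes are
empty, this defect is \<open>1\<close>.\<close>

lemma gain_telescope:
  fixes q :: "'a::field" and l :: nat
  assumes q: "q \<noteq> 0" and nu: "\<And>i. \<nu> (Suc i) \<le> \<nu> i" and ka: "\<And>i. \<kappa> (Suc i) \<le> \<kappa> i" "\<And>i. \<kappa> i \<le> Suc (\<nu> i)"
  defines "L \<equiv> \<lambda>i. case i of 0 \<Rightarrow> first_row_gain q l (\<nu> 0) (\<kappa> 0) | Suc j \<Rightarrow> outer_gain q l j (\<nu> j) (\<kappa> j) (\<nu> i) (\<kappa> i)"
  defines "M \<equiv> \<lambda>i. inner_gain q l i (\<nu> i) (\<kappa> i) (\<nu> (Suc i)) (\<kappa> (Suc i))"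
  shows "(\<Prod>i<Suc N. q ^ \<nu> i * (L i True + L i False)) * defect q l N (\<nu> N) (\<kappa> N)
    = q ^ l * (\<Prod>i<N. M i True + M i False) * own_factor q l N (\<nu> N) (\<kappa> N)"
proof (induction N)
  case 0
  then show ?case using first_row_gain_sum[OF q ka(2)[of 0]] by (simp add: L_def)
next
  case (Suc N)
  let ?v = "interaction q l N (\<nu> N) (\<kappa> N) (\<nu> (Suc N)) (\<kappa> (Suc N))"
  have "(\<Prod>i<Suc (Suc N). q ^ \<nu> i * (L i True + L i False)) * defect q l (Suc N) (\<nu> (Suc N)) (\<kappa> (Suc N))
    = (\<Prod>i<Suc N. q ^ \<nu> i * (L i True + L i False)) * (q ^ \<nu> (Suc N) * (L (Suc N) True + L (Suc N) False) * defect q l (Suc N) (\<nu> (Suc N)) (\<kappa> (Suc N)))"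
    by (simp add: mult_ac)
  also have "q ^ \<nu> (Suc N) * (L (Suc N) True + L (Suc N) False) * defect q l (Suc N) (\<nu> (Suc N)) (\<kappa> (Suc N))
    = own_factor q l (Suc N) (\<nu> (Suc N)) (\<kappa> (Suc N)) * defect q l N (\<nu> N) (\<kappa> N) * ?v"
    unfolding L_def using outer_gain_sum[OF q nu ka] ka(2) by simp
  also have "(\<Prod>i<Suc N. q ^ \<nu> i * (L i True + L i False)) * \<dots>
     = ((\<Prod>i<Suc N. q ^ \<nu> i * (L i True + L i False)) * defect q l N (\<nu> N) (\<kappa> N)) * ?v * own_factor q l (Suc N) (\<nu> (Suc N)) (\<kappa> (Suc N))"
    by (simp add: mult_ac)
  also have "\<dots> = q ^ l * (\<Prod>i<N. M i True + M i False) * (own_factor q l N (\<nu> N) (\<kappa> N) * ?v) * own_factor q l (Suc N) (\<nu> (Suc N)) (\<kappa> (Suc N))"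
    unfolding Suc.IH by (simp only: mult_ac)
  also have "own_factor q l N (\<nu> N) (\<kappa> N) * ?v = M N True + M N False"
    unfolding M_def using inner_gain_sum[OF q nu ka] ka(2) by simp
  finally show ?case by (simp add: mult_ac)
qed

text \<open>Coefficient of \<open>f \<kappa>\<close> in the first order of the operators: the sets of added corners are extended to
all sets of rows, since sets containing a row that is not addable contribute a zero factor.\<close>

lemma pieri_transfer_left:
  fixes q :: "'a::field" and l :: nat
  assumes sh: "shape \<nu>" and M: "\<forall>i\<ge>M. \<nu> i = 0"
  defines "L \<equiv> \<lambda>\<kappa> i. case i of 0 \<Rightarrow> first_row_gain q l (\<nu> 0) (\<kappa> 0) | Suc j \<Rightarrow> outer_gain q l j (\<nu> j) (\<kappa> j) (\<nu> i) (\<kappa> i)"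
  shows "pieri q (transfer q l f) \<nu> =
    (\<Sum>\<kappa>\<in>near \<nu> (Suc M). f \<kappa> * (\<Prod>i<Suc (Suc M). q ^ \<nu> i * (L \<kappa> i True + L \<kappa> i False)))"
proof -
  \<comment> \<open>Adding corners can produce one row more than \<open>\<nu>\<close> has; one further row is included so that the
    last row is empty in all shapes and has trivial factors.\<close>
  let ?A = "{..<Suc (Suc M)}" and ?K = "near \<nu> (Suc M)"
  have ad: "addable \<nu> \<subseteq> ?A" using addable_bound[OF M] by force
  have z: "add_rows \<nu> S i = 0" if "i \<ge> Suc M" "S \<subseteq> addable \<nu>" for i S
    using addable_bound[OF M] M that by (auto simp: add_rows_def)
  have tr: "transfer q l f (add_rows \<nu> S) = (\<Sum>\<kappa>\<in>?K. f \<kappa> *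
     (\<Prod>i\<in>?A. strip q l i (add_rows \<nu> S i) (\<kappa> i) * turn q l i (\<kappa> i) (add_rows \<nu> S (Suc i))))"
    if S: "S \<subseteq> addable \<nu>" for S
  proof -
    have "transfer q l f (add_rows \<nu> S)
      = (\<Sum>\<kappa>\<in>?K. f \<kappa> * (if \<kappa> \<in> interlaced (add_rows \<nu> S) then branch q l (add_rows \<nu> S) \<kappa> else 0))"
      unfolding transfer_def
      by (rule sum.mono_neutral_cong_left) (use interlaced_add_rows_near[OF sh M S] finite_near in auto)
    also have "\<dots> = (\<Sum>\<kappa>\<in>?K. f \<kappa> *
     (\<Prod>i\<in>?A. strip q l i (add_rows \<nu> S i) (\<kappa> i) * turn q l i (\<kappa> i) (add_rows \<nu> S (Suc i))))"
    proof (rule sum.cong[OF refl], rule arg_cong[where f = "(*) _"], rule branch_eq)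
      fix \<kappa> assume "\<kappa> \<in> ?K"
      then show "\<forall>i\<ge>Suc (Suc M). \<kappa> i = 0" by (simp add: near_def)
    qed (use z S in auto)
    finally show ?thesis .
  qed
  have co: "(- 1) ^ card S * (\<Prod>i\<in>?A. strip q l i (add_rows \<nu> S i) (\<kappa> i) * turn q l i (\<kappa> i) (add_rows \<nu> S (Suc i)))
     = (\<Prod>i\<in>?A. L \<kappa> i (i \<in> S))" if S: "S \<subseteq> addable \<nu>" and k: "\<kappa> \<in> ?K" for S \<kappa>
  proof -
    have t0: "turn q l (Suc M) (\<kappa> (Suc M)) (add_rows \<nu> S (Suc (Suc M))) = 1"
      using k z[OF _ S] by (simp add: near_def turn_def)
    have gl: "L \<kappa> (Suc i) (Suc i \<in> S) = row_sign (Suc i \<in> S) * strip q l (Suc i) (add_rows \<nu> S (Suc i)) (\<kappa> (Suc i))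
        * turn q l i (\<kappa> i) (add_rows \<nu> S (Suc i))" for i
      using S by (auto simp: L_def outer_gain_def add_rows_def addable_def)
    have "(\<Prod>i\<in>?A. strip q l i (add_rows \<nu> S i) (\<kappa> i) * turn q l i (\<kappa> i) (add_rows \<nu> S (Suc i)))
      = (\<Prod>i\<in>?A. strip q l i (add_rows \<nu> S i) (\<kappa> i)) * (\<Prod>i<Suc M. turn q l i (\<kappa> i) (add_rows \<nu> S (Suc i)))"
      using t0 by (simp add: prod.distrib mult_ac)
    moreover have "(- 1) ^ card S = (\<Prod>i\<in>?A. row_sign (i \<in> S) :: 'a)"
      by (rule prod_row_sign[symmetric]) (use S ad in auto)
    ultimately have "(- 1) ^ card S * (\<Prod>i\<in>?A. strip q l i (add_rows \<nu> S i) (\<kappa> i) * turn q l i (\<kappa> i) (add_rows \<nu> S (Suc i)))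
      = (\<Prod>i\<in>?A. row_sign (i \<in> S) * strip q l i (add_rows \<nu> S i) (\<kappa> i)) * (\<Prod>i<Suc M. turn q l i (\<kappa> i) (add_rows \<nu> S (Suc i)))"
      by (simp only: prod.distrib mult_ac)
    also have "\<dots> = row_sign (0 \<in> S) * strip q l 0 (add_rows \<nu> S 0) (\<kappa> 0) * (\<Prod>i<Suc M. L \<kappa> (Suc i) (Suc i \<in> S))"
      unfolding gl prod.lessThan_Suc_shift[of _ "Suc M"] by (simp only: prod.distrib mult_ac)
    also have "row_sign (0 \<in> S) * strip q l 0 (add_rows \<nu> S 0) (\<kappa> 0) = L \<kappa> 0 (0 \<in> S)"
      by (simp add: L_def first_row_gain_def add_rows_def)
    finally show ?thesis unfolding prod.lessThan_Suc_shift[of _ "Suc M"] .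
  qed
  have vanish: "(\<Prod>i\<in>?A. L \<kappa> i (i \<in> S)) = 0" if S: "S \<in> Pow ?A - Pow (addable \<nu>)" for S \<kappa>
  proof -
    from S obtain i where i: "i \<in> S" "i \<in> ?A" "i \<notin> addable \<nu>" by auto
    then obtain j where j: "i = Suc j" "\<nu> j \<le> \<nu> i" by (cases i) (auto simp: addable_def)
    have "L \<kappa> i (i \<in> S) = 0" using i j by (simp add: L_def outer_gain_def)
    then show ?thesis using i by (meson finite_lessThan prod_zero)
  qed
  have "(\<Sum>S\<in>Pow (addable \<nu>). (- 1) ^ card S * transfer q l f (add_rows \<nu> S))
     = (\<Sum>S\<in>Pow (addable \<nu>). \<Sum>\<kappa>\<in>?K. f \<kappa> * (\<Prod>i\<in>?A. L \<kappa> i (i \<in> S)))"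
  proof (rule sum.cong[OF refl])
    fix S assume "S \<in> Pow (addable \<nu>)"
    then have S: "S \<subseteq> addable \<nu>" by simp
    have "(- 1) ^ card S * transfer q l f (add_rows \<nu> S) =
      (\<Sum>\<kappa>\<in>?K. f \<kappa> * ((- 1) ^ card S * (\<Prod>i\<in>?A. strip q l i (add_rows \<nu> S i) (\<kappa> i) * turn q l i (\<kappa> i) (add_rows \<nu> S (Suc i)))))"
      unfolding tr[OF S] sum_distrib_left by (simp only: mult_ac)
    then show "(- 1) ^ card S * transfer q l f (add_rows \<nu> S) = (\<Sum>\<kappa>\<in>?K. f \<kappa> * (\<Prod>i\<in>?A. L \<kappa> i (i \<in> S)))"
      using co[OF S] by (simp cong: sum.cong)
  qed
  also have "\<dots> = (\<Sum>\<kappa>\<in>?K. f \<kappa> * (\<Sum>S\<in>Pow (addable \<nu>). \<Prod>i\<in>?A. L \<kappa> i (i \<in> S)))"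
    by (subst sum.swap) (simp only: sum_distrib_left)
  also have "\<dots> = (\<Sum>\<kappa>\<in>?K. f \<kappa> * (\<Sum>S\<in>Pow ?A. \<Prod>i\<in>?A. L \<kappa> i (i \<in> S)))"
    by (rule sum.cong[OF refl], rule arg_cong[where f = "(*) _"], rule sum.mono_neutral_left)
       (use ad vanish in auto)
  also have "\<dots> = (\<Sum>\<kappa>\<in>?K. f \<kappa> * (\<Prod>i\<in>?A. L \<kappa> i True + L \<kappa> i False))"
    by (simp only: Pow_sum_prod[OF finite_lessThan])
  finally have "pieri q (transfer q l f) \<nu> = q ^ size_of \<nu> * (\<Sum>\<kappa>\<in>?K. f \<kappa> * (\<Prod>i\<in>?A. L \<kappa> i True + L \<kappa> i False))"
    by (simp add: pieri_def)
  moreover have "q ^ size_of \<nu> = (\<Prod>i\<in>?A. q ^ \<nu> i)"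
    using size_of_eq[of "Suc (Suc M)" \<nu>] M by (simp add: power_sum del: prod.lessThan_Suc sum.lessThan_Suc)
  ultimately show ?thesis
    by (simp only: sum_distrib_left prod.distrib mult_ac)
qed

text \<open>Coefficient of \<open>f \<kappa>\<close> in the opposite order: a shape with a set of corners to be added is traded for the
enlarged shape \<open>\<kappa>\<close> with the set of rows that lose a cell, and the conditions on the latter become local.\<close>

lemma pieri_transfer_right:
  fixes q :: "'a::field" and l :: nat
  assumes sh: "shape \<nu>" and M: "\<forall>i\<ge>M. \<nu> i = 0"
  defines "G \<equiv> \<lambda>\<kappa> i. inner_gain q l i (\<nu> i) (\<kappa> i) (\<nu> (Suc i)) (\<kappa> (Suc i))"
  shows "transfer q l (pieri q f) \<nu> =
    (\<Sum>\<kappa>\<in>near \<nu> (Suc M). f \<kappa> * (\<Prod>i<Suc (Suc M). G \<kappa> i True + G \<kappa> i False))"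
proof -
  let ?A = "{..<Suc (Suc M)}" and ?K = "near \<nu> (Suc M)"
  let ?rem = "\<lambda>\<kappa> S i. \<kappa> i - of_bool (i \<in> S) :: nat"
  let ?ok = "\<lambda>\<kappa> S. (\<forall>i\<in>S. 0 < \<kappa> i) \<and> ?rem \<kappa> S \<in> interlaced \<nu> \<and> S \<subseteq> addable (?rem \<kappa> S)"
  let ?t = "\<lambda>\<kappa> S. (- 1) ^ card S * branch q l \<nu> (?rem \<kappa> S) * q ^ size_of (?rem \<kappa> S)"
  have bz: "\<kappa> i = 0" if "\<kappa> \<in> interlaced \<nu>" "i \<ge> M" for \<kappa> i
    using that M by (simp add: interlaced_def) (metis le_zero_eq)
  have fin: "finite (Pow (addable \<kappa>))" if "\<kappa> \<in> interlaced \<nu>" for \<kappa>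
    using addable_bound[of M \<kappa>] bz[OF that] finite_subset by blast
  have "transfer q l (pieri q f) \<nu> = (\<Sum>\<kappa>\<in>interlaced \<nu>. \<Sum>S\<in>Pow (addable \<kappa>).
     f (add_rows \<kappa> S) * ((- 1) ^ card S * branch q l \<nu> \<kappa> * q ^ size_of \<kappa>))"
    unfolding transfer_def pieri_def sum_distrib_left by (simp only: mult_ac)
  also have "\<dots> = (\<Sum>(\<kappa>, S)\<in>Sigma (interlaced \<nu>) (\<lambda>\<kappa>. Pow (addable \<kappa>)).
     f (add_rows \<kappa> S) * ((- 1) ^ card S * branch q l \<nu> \<kappa> * q ^ size_of \<kappa>))"
    by (rule sum.Sigma) (use fin finite_interlaced[OF sh] in auto)
  also have "\<dots> = (\<Sum>(\<kappa>, S)\<in>{(\<kappa>, S). \<kappa> \<in> ?K \<and> S \<in> Pow ?A \<and> ?ok \<kappa> S}. f \<kappa> * ?t \<kappa> S)"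
  proof (rule sum.reindex_bij_witness[where i = "\<lambda>(\<kappa>, S). (?rem \<kappa> S, S)" and j = "\<lambda>(\<kappa>, S). (add_rows \<kappa> S, S)"])
    fix a assume "a \<in> Sigma (interlaced \<nu>) (\<lambda>\<kappa>. Pow (addable \<kappa>))"
    then obtain \<kappa> S where a: "a = (\<kappa>, S)" "\<kappa> \<in> interlaced \<nu>" "S \<subseteq> addable \<kappa>" by auto
    have r: "?rem (add_rows \<kappa> S) S = \<kappa>" by (auto simp: add_rows_def)
    show "(case (case a of (\<kappa>, S) \<Rightarrow> (add_rows \<kappa> S, S)) of (\<kappa>, S) \<Rightarrow> (?rem \<kappa> S, S)) = a"
      using r by (simp add: a)
    have S: "S \<subseteq> ?A" using addable_bound[of M \<kappa>] bz a by force
    have "add_rows \<kappa> S \<in> ?K"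
    proof -
      have "shape (add_rows \<kappa> S)" using shape_add_rows shape_interlaced[OF sh] a by blast
      moreover have "add_rows \<kappa> S i \<le> Suc (\<nu> i)" for i
        using a(2) by (simp add: add_rows_def interlaced_def of_bool_def le_SucI)
      moreover have "add_rows \<kappa> S i = 0" if "i \<ge> Suc M" for i
        using addable_bound[of M \<kappa>] bz a that by (auto simp: add_rows_def)
      ultimately show ?thesis by (simp add: near_def shape_def)
    qed
    then show "(case a of (\<kappa>, S) \<Rightarrow> (add_rows \<kappa> S, S)) \<in> {(\<kappa>, S). \<kappa> \<in> ?K \<and> S \<in> Pow ?A \<and> ?ok \<kappa> S}"
      using a S r by (simp add: add_rows_def)
    show "(case case a of (\<kappa>, S) \<Rightarrow> (add_rows \<kappa> S, S) of (\<kappa>, S) \<Rightarrow> f \<kappa> * ?t \<kappa> S)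
       = (case a of (\<kappa>, S) \<Rightarrow> f (add_rows \<kappa> S) * ((- 1) ^ card S * branch q l \<nu> \<kappa> * q ^ size_of \<kappa>))"
      using r by (simp add: a)
  next
    fix b assume "b \<in> {(\<kappa>, S). \<kappa> \<in> ?K \<and> S \<in> Pow ?A \<and> ?ok \<kappa> S}"
    then obtain \<kappa> S where b: "b = (\<kappa>, S)" "?ok \<kappa> S" by auto
    have "add_rows (?rem \<kappa> S) S = \<kappa>" using b by (auto simp: add_rows_def fun_eq_iff)
    then show "(case (case b of (\<kappa>, S) \<Rightarrow> (?rem \<kappa> S, S)) of (\<kappa>, S) \<Rightarrow> (add_rows \<kappa> S, S)) = b"
      by (simp add: b)
    show "(case b of (\<kappa>, S) \<Rightarrow> (?rem \<kappa> S, S)) \<in> Sigma (interlaced \<nu>) (\<lambda>\<kappa>. Pow (addable \<kappa>))"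
      using b by simp
  qed
  also have "\<dots> = (\<Sum>(\<kappa>, S)\<in>?K \<times> Pow ?A. f \<kappa> * (if ?ok \<kappa> S then ?t \<kappa> S else 0))"
    by (rule sum.mono_neutral_cong_left) (auto simp: finite_near split: if_splits)
  also have "\<dots> = (\<Sum>\<kappa>\<in>?K. f \<kappa> * (\<Sum>S\<in>Pow ?A. if ?ok \<kappa> S then ?t \<kappa> S else 0))"
    by (simp add: sum.cartesian_product[symmetric] sum_distrib_left)
  also have "\<dots> = (\<Sum>\<kappa>\<in>?K. f \<kappa> * (\<Sum>S\<in>Pow ?A. \<Prod>i\<in>?A. G \<kappa> i (i \<in> S)))"
  proof (rule sum.cong[OF refl], rule arg_cong[where f = "(*) _"], rule sum.cong[OF refl])
    fix \<kappa> S assume k: "\<kappa> \<in> ?K" and S: "S \<in> Pow ?A"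
    have anti: "\<kappa> (Suc i) \<le> \<kappa> i" for i using k by (auto simp: near_def antimono_iff_le_Suc)
    have kz: "i \<ge> Suc M \<Longrightarrow> \<kappa> i = 0" for i using k by (simp add: near_def)
    have bel: "(if ?rem \<kappa> S \<in> interlaced \<nu> then branch q l \<nu> (?rem \<kappa> S) else 0)
       = (\<Prod>i\<in>?A. strip q l i (\<nu> i) (?rem \<kappa> S i) * turn q l i (?rem \<kappa> S i) (\<nu> (Suc i)))"
      by (rule branch_eq) (use M kz in auto)
    show "(if ?ok \<kappa> S then ?t \<kappa> S else 0) = (\<Prod>i\<in>?A. G \<kappa> i (i \<in> S))"
    proof (cases "\<forall>i\<in>?A. (i \<in> S \<longrightarrow> 0 < \<kappa> i) \<and> \<kappa> (Suc i) \<le> ?rem \<kappa> S i")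
      case False
      then obtain i where i: "i \<in> ?A" "(i \<in> S \<and> \<kappa> i = 0) \<or> ?rem \<kappa> S i < \<kappa> (Suc i)"
        by (auto simp: not_le)
      then have "G \<kappa> i (i \<in> S) = 0" by (auto simp: G_def inner_gain_def)
      then have "(\<Prod>i\<in>?A. G \<kappa> i (i \<in> S)) = 0" using i(1) by (meson finite_lessThan prod_zero)
      moreover have "\<not> ?ok \<kappa> S"
      proof
        assume ok: "?ok \<kappa> S"
        with i have lt: "?rem \<kappa> S i < \<kappa> (Suc i)" by auto
        show False
        proof (cases "Suc i \<in> S")
          case True
          with ok have "Suc i \<in> addable (?rem \<kappa> S)" "0 < \<kappa> (Suc i)" by auto
          with True lt show False by (simp add: addable_def)
        next
          case False
          have "shape (?rem \<kappa> S)" using ok shape_interlaced[OF sh] by blast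
          from shape_antimono[OF this, of i "Suc i"] False lt show False by simp
        qed
      qed
      ultimately show ?thesis by (simp only: if_False)
    next
      case True
      have iA: "(i \<in> S \<longrightarrow> 0 < \<kappa> i) \<and> \<kappa> (Suc i) \<le> ?rem \<kappa> S i" for i
        using True S kz[of i] kz[of "Suc i"] by (cases "i \<in> ?A") auto
      have "(\<Prod>i\<in>?A. G \<kappa> i (i \<in> S)) = (\<Prod>i\<in>?A. row_sign (i \<in> S) * q ^ ?rem \<kappa> S i * (strip q l i (\<nu> i) (?rem \<kappa> S i) * turn q l i (?rem \<kappa> S i) (\<nu> (Suc i))))"
      proof (rule prod.cong[OF refl])
        fix i
        have "\<not> (i \<in> S \<and> \<kappa> i = 0 \<or> \<kappa> i - of_bool (i \<in> S) < \<kappa> (Suc i))" using iA[of i] by auto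
        then show "G \<kappa> i (i \<in> S) = row_sign (i \<in> S) * q ^ ?rem \<kappa> S i * (strip q l i (\<nu> i) (?rem \<kappa> S i) * turn q l i (?rem \<kappa> S i) (\<nu> (Suc i)))"
          unfolding G_def inner_gain_def by (simp only: if_False mult.assoc)
      qed
      also have "\<dots> = (\<Prod>i\<in>?A. row_sign (i \<in> S)) * (\<Prod>i\<in>?A. q ^ ?rem \<kappa> S i) * (if ?rem \<kappa> S \<in> interlaced \<nu> then branch q l \<nu> (?rem \<kappa> S) else 0)"
        unfolding bel by (simp only: prod.distrib)
      also have "(\<Prod>i\<in>?A. row_sign (i \<in> S)) = (- 1 :: 'a) ^ card S"
        using prod_row_sign[of S ?A] S by (simp del: prod.lessThan_Suc)
      also have "(\<Prod>i\<in>?A. q ^ ?rem \<kappa> S i) = q ^ size_of (?rem \<kappa> S)"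
        using size_of_eq[of "Suc (Suc M)" "?rem \<kappa> S"] kz by (simp add: power_sum del: prod.lessThan_Suc sum.lessThan_Suc)
      finally have e: "(\<Prod>i\<in>?A. G \<kappa> i (i \<in> S)) = (if ?rem \<kappa> S \<in> interlaced \<nu> then ?t \<kappa> S else 0)"
        by (simp add: mult_ac)
      have "S \<subseteq> addable (?rem \<kappa> S)"
      proof
        fix i assume i: "i \<in> S"
        show "i \<in> addable (?rem \<kappa> S)"
        proof (cases i)
          case (Suc j)
          have "\<kappa> (Suc j) \<le> ?rem \<kappa> S j" "0 < \<kappa> (Suc j)" using iA[of j] iA[of "Suc j"] i Suc by auto
          then show ?thesis using i Suc by (simp add: addable_def)
        qed (simp add: addable_def)
      qed
      with iA have "?ok \<kappa> S \<longleftrightarrow> ?rem \<kappa> S \<in> interlaced \<nu>" by auto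
      then show ?thesis unfolding e by simp
    qed
  qed
  also have "\<dots> = (\<Sum>\<kappa>\<in>?K. f \<kappa> * (\<Prod>i\<in>?A. G \<kappa> i True + G \<kappa> i False))"
    by (simp only: Pow_sum_prod[OF finite_lessThan])
  finally show ?thesis .
qed

text \<open>The commutation relation behind the whole argument. Both sides have been expanded over the same shapes
\<open>\<kappa>\<close>, with coefficients that factor over the rows, and the factors telescope.\<close>

theorem pieri_transfer:
  fixes q :: "'a::field"
  assumes q: "q \<noteq> 0" and sh: "shape \<nu>"
  shows "pieri q (transfer q l f) \<nu> = q ^ l * transfer q l (pieri q f) \<nu>"
proof -
  obtain M where M: "\<forall>i\<ge>M. \<nu> i = 0" using shapeE[OF sh] by blast
  show ?thesis
    unfolding pieri_transfer_left[OF sh M] pieri_transfer_right[OF sh M] sum_distrib_left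
  proof (rule sum.cong[OF refl])
    fix \<kappa> assume k: "\<kappa> \<in> near \<nu> (Suc M)"
    have nu: "\<nu> (Suc i) \<le> \<nu> i" for i using shape_antimono[OF sh] by simp
    have ka: "\<kappa> (Suc i) \<le> \<kappa> i" for i using k by (auto simp: near_def antimono_iff_le_Suc)
    have kn: "\<kappa> i \<le> Suc (\<nu> i)" for i using k by (auto simp: near_def)
    have z: "\<kappa> (Suc M) = 0" "\<kappa> (Suc (Suc M)) = 0" "\<nu> (Suc M) = 0" "\<nu> (Suc (Suc M)) = 0" using k M by (auto simp: near_def)
    let ?G = "\<lambda>i. inner_gain q l i (\<nu> i) (\<kappa> i) (\<nu> (Suc i)) (\<kappa> (Suc i))"
    let ?L = "\<lambda>i. case i of 0 \<Rightarrow> first_row_gain q l (\<nu> 0) (\<kappa> 0) | Suc j \<Rightarrow> outer_gain q l j (\<nu> j) (\<kappa> j) (\<nu> i) (\<kappa> i)"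
    have "(\<Prod>i<Suc (Suc M). q ^ \<nu> i * (?L i True + ?L i False)) = q ^ l * (\<Prod>i<Suc M. ?G i True + ?G i False)"
      using gain_telescope[where \<nu> = \<nu> and \<kappa> = \<kappa> and N = "Suc M", OF q nu ka kn] z by (simp add: defect_def own_factor_def)
    moreover have "?G (Suc M) True + ?G (Suc M) False = 1"
      using z by (simp add: inner_gain_def row_sign_def turn_def)
    ultimately show "f \<kappa> * (\<Prod>i<Suc (Suc M). q ^ \<nu> i * (?L i True + ?L i False)) =
         q ^ l * (f \<kappa> * (\<Prod>i<Suc (Suc M). ?G i True + ?G i False))"
      by (simp add: mult_ac)
  qed
qed

section \<open>Sums over interlacing patterns\<close>

text \<open>The sum over diagrams as iterated transfer. The shapes are not required to fit into \<open>\<lambda>\<close>; the weights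
vanish by themselves when they do not.\<close>

fun pattern_sum :: "'a::field \<Rightarrow> nat list \<Rightarrow> (nat \<Rightarrow> nat) \<Rightarrow> 'a" where
  "pattern_sum q [] \<nu> = of_bool (\<nu> = (\<lambda>_. 0))"
| "pattern_sum q (l # la) \<nu> = transfer q l (pattern_sum q la) \<nu>"

lemma shape_zero: "shape (\<lambda>_. 0)"
  by (simp add: shape_def antimono_def)

lemma interlaced_zero: "interlaced (\<lambda>_. 0) = {\<lambda>_. 0}"
  by (auto simp: interlaced_def)

lemma addable_zero: "addable (\<lambda>_. 0) = {0}"
  by (auto simp: addable_def)

lemma size_of_zero: "size_of (\<lambda>_. 0) = 0"
  by (simp add: size_of_def)

lemma pieri_pattern_sum:
  fixes q :: "'a::field"
  assumes q: "q \<noteq> 0"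
  shows "shape \<nu> \<Longrightarrow> pieri q (pattern_sum q la) \<nu> = q ^ sum_list la * pattern_sum q la \<nu>"
proof (induction la arbitrary: \<nu>)
  case Nil
  show ?case
  proof (cases "\<nu> = (\<lambda>_. 0)")
    case True
    have "Pow {0::nat} = {{}, {0}}" by auto
    then show ?thesis unfolding True pieri_def
      by (simp add: addable_zero size_of_zero add_rows_def fun_eq_iff)
  next
    case False
    then have "add_rows \<nu> S \<noteq> (\<lambda>_. 0)" for S
      unfolding add_rows_def fun_eq_iff by fastforce
    then show ?thesis using False by (simp add: pieri_def)
  qed
next
  case (Cons l la)
  have eq: "pattern_sum q (l # la) = transfer q l (pattern_sum q la)" by (rule ext) simp
  have "pieri q (pattern_sum q (l # la)) \<nu> = q ^ l * transfer q l (pieri q (pattern_sum q la)) \<nu>"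
    unfolding eq by (rule pieri_transfer[OF q Cons.prems])
  also have "transfer q l (pieri q (pattern_sum q la)) \<nu>
     = (\<Sum>\<kappa>\<in>interlaced \<nu>. branch q l \<nu> \<kappa> * (q ^ sum_list la * pattern_sum q la \<kappa>))"
    unfolding transfer_def using Cons.IH shape_interlaced[OF Cons.prems] by (intro sum.cong) auto
  also have "\<dots> = q ^ sum_list la * transfer q l (pattern_sum q la) \<nu>"
    unfolding transfer_def sum_distrib_left by (simp only: mult_ac)
  finally show ?case by (simp add: power_add mult_ac)
qed

lemma pattern_sum_zero: "pattern_sum q la (\<lambda>_. 0) = 1"
  by (induction la) (simp_all add: transfer_def interlaced_zero branch_def)

lemma part_Cons_Suc: "0 < i \<Longrightarrow> part (l # la) (Suc i) = part la i"
  by (auto simp: part_def nth_Cons split: nat.splits)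

lemma part_Cons_1: "part (l # la) (Suc 0) = l"
  by (simp add: part_def)

text \<open>If the first row of the current shape exceeds the current part \<open>l\<close>, then either it drops to at most \<open>l\<close>
in this step, so that the strip contains the cell of content \<open>l\<close> whose weight is \<open>1 - q ^ 0\<close>, or it still
exceeds the next part. The first row must drop at the end. A lower row exceeding its part is inherited,
by interlacing, by the row above it in the next shape.\<close>

lemma pattern_sum_vanishes:
  fixes q :: "'a::field"
  assumes q: "q \<noteq> 0"
  shows "sorted_wrt (\<ge>) la \<Longrightarrow> shape \<nu> \<Longrightarrow> part la (Suc i) < \<nu> i \<Longrightarrow> pattern_sum q la \<nu> = 0"
proof (induction la arbitrary: \<nu> i)
  case Nil
  then show ?case by auto
next
  case (Cons l la)
  have le: "part la (Suc 0) \<le> l" using Cons.prems(1) by (cases la) (auto simp: part_def)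
  have "branch q l \<nu> \<kappa> * pattern_sum q la \<kappa> = 0" if k: "\<kappa> \<in> interlaced \<nu>" for \<kappa>
  proof (cases "i = 0 \<and> \<kappa> 0 \<le> l")
    case True
    then have "strip q l 0 (\<nu> 0) (\<kappa> 0) = 0"
      using Cons.prems(3) q by (auto simp: strip_def part_Cons_1 intro!: bexI[of _ l])
    moreover have "finite {i. 0 < \<nu> i}" "0 \<in> {i. 0 < \<nu> i}"
      using Cons.prems(2,3) True by (auto simp: shape_def)
    ultimately have "branch q l \<nu> \<kappa> = 0" unfolding branch_def
      by (intro prod_zero) (auto intro!: bexI[of _ 0])
    then show ?thesis by simp
  next
    case False
    have "\<exists>j. part la (Suc j) < \<kappa> j"
    proof (cases i)
      case 0
      then show ?thesis using False le by (intro exI[of _ 0]) simp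
    next
      case (Suc j)
      have "\<nu> (Suc j) \<le> \<kappa> j" using k by (simp add: interlaced_def)
      then show ?thesis using Cons.prems(3) Suc by (intro exI[of _ j]) (simp add: part_Cons_Suc)
    qed
    then have "pattern_sum q la \<kappa> = 0"
      using Cons.IH[of \<kappa>] Cons.prems shape_interlaced[OF _ k] by auto
    then show ?thesis by simp
  qed
  then show ?case unfolding pattern_sum.simps transfer_def by (intro sum.neutral) blast
qed

text \<open>Chains of interlacing shapes, in other words Gelfand-Tsetlin patterns of top row \<open>\<nu>\<close>. If \<open>\<nu>\<close> is a shape, the
bound on first rows makes all shapes empty from index \<open>length la\<close> on.\<close>

definition patterns :: "nat list \<Rightarrow> (nat \<Rightarrow> nat) \<Rightarrow> (nat \<Rightarrow> nat \<Rightarrow> nat) set" where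
  "patterns la \<nu> = {P. P 0 = \<nu> \<and> (\<forall>k. P (Suc k) \<in> interlaced (P k)) \<and> (\<forall>k. P k 0 \<le> part la (Suc k))}"

lemma patterns_shape:
  assumes "P \<in> patterns la \<nu>" "shape \<nu>"
  shows "shape (P k)"
  using assms by (induction k) (auto simp: patterns_def intro: shape_interlaced)

lemma patterns_Nil:
  assumes "shape \<nu>"
  shows "patterns [] \<nu> = (if \<nu> = (\<lambda>_. 0) then {\<lambda>_ _. 0} else {})"
proof -
  have "P k = (\<lambda>_. 0)" if P: "P \<in> patterns [] \<nu>" for P k
  proof
    fix i
    have "P k i \<le> P k 0" using shape_antimono[OF patterns_shape[OF P assms]] by blast
    also have "\<dots> = 0" using P by (simp add: patterns_def part_def)
    finally show "P k i = 0" by simp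
  qed
  then have a: "P = (\<lambda>_ _. 0)" if "P \<in> patterns [] \<nu>" for P
    using that by blast
  have b: "(\<lambda>_ _. 0) \<in> patterns [] (\<lambda>_. 0)" by (simp add: patterns_def interlaced_zero)
  have c: "\<nu> = (\<lambda>_. 0)" if "P \<in> patterns [] \<nu>" for P
    using that a[OF that] by (simp add: patterns_def)
  show ?thesis
  proof (cases "\<nu> = (\<lambda>_. 0)")
    case True
    show ?thesis unfolding True if_P[OF refl]
      using a b unfolding True by blast
  next
    case False
    then show ?thesis using c by (simp only: if_False) blast
  qed
qed

text \<open>Cutting off the first shape of a chain; it corresponds to the outermost transfer operator.\<close>

lemma patterns_Cons:
  assumes "\<nu> 0 \<le> l"
  shows "bij_betw (\<lambda>(\<kappa>, P). case_nat \<nu> P) (Sigma (interlaced \<nu>) (patterns la)) (patterns (l # la) \<nu>)"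
proof (rule bij_betwI[where g = "\<lambda>P. (P 1, \<lambda>k. P (Suc k))"])
  show "(\<lambda>(\<kappa>, P). case_nat \<nu> P) \<in> Sigma (interlaced \<nu>) (patterns la) \<rightarrow> patterns (l # la) \<nu>"
  proof
    fix x assume "x \<in> Sigma (interlaced \<nu>) (patterns la)"
    then obtain \<kappa> P where x: "x = (\<kappa>, P)" "\<kappa> \<in> interlaced \<nu>" "P \<in> patterns la \<kappa>" by auto
    have "case_nat \<nu> P (Suc k) \<in> interlaced (case_nat \<nu> P k)" for k
      using x by (cases k) (auto simp: patterns_def)
    moreover have "case_nat \<nu> P k 0 \<le> part (l # la) (Suc k)" for k
      using x assms by (cases k) (auto simp: patterns_def part_Cons_1 part_Cons_Suc)
    ultimately show "(case x of (\<kappa>, P) \<Rightarrow> case_nat \<nu> P) \<in> patterns (l # la) \<nu>"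
      by (simp add: x patterns_def)
  qed
  show "(\<lambda>P. (P 1, \<lambda>k. P (Suc k))) \<in> patterns (l # la) \<nu> \<rightarrow> Sigma (interlaced \<nu>) (patterns la)"
    by (auto simp: patterns_def part_Cons_Suc) (metis part_Cons_Suc zero_less_Suc)
  show "(\<lambda>P. (P 1, \<lambda>k. P (Suc k))) (case x of (\<kappa>, P) \<Rightarrow> case_nat \<nu> P) = x"
    if "x \<in> Sigma (interlaced \<nu>) (patterns la)" for x
    using that by (auto simp: patterns_def)
  show "(case (P 1, \<lambda>k. P (Suc k)) of (\<kappa>, P) \<Rightarrow> case_nat \<nu> P) = P"
    if "P \<in> patterns (l # la) \<nu>" for P
    using that by (auto simp: patterns_def fun_eq_iff split: nat.splits)
qed

lemma pattern_sum_eq: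
  fixes q :: "'a::field"
  assumes q: "q \<noteq> 0"
  shows "sorted_wrt (\<ge>) la \<Longrightarrow> shape \<nu> \<Longrightarrow> finite (patterns la \<nu>) \<and>
    pattern_sum q la \<nu> = (\<Sum>P\<in>patterns la \<nu>. \<Prod>k<length la. branch q (la ! k) (P k) (P (Suc k)))"
proof (induction la arbitrary: \<nu>)
  case Nil
  then show ?case by (simp add: patterns_Nil)
next
  case (Cons l la)
  show ?case
  proof (cases "\<nu> 0 \<le> l")
    case False
    have "\<nu> 0 \<le> l" if "P \<in> patterns (l # la) \<nu>" for P
      using that part_Cons_1[of l la] unfolding patterns_def by (metis (mono_tags, lifting) mem_Collect_eq)
    with False have "patterns (l # la) \<nu> = {}" by blast
    moreover have "pattern_sum q (l # la) \<nu> = 0"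
      using False by (intro pattern_sum_vanishes[OF q Cons.prems, of 0]) (simp add: part_Cons_1)
    ultimately show ?thesis by simp
  next
    case True
    note bij = patterns_Cons[of \<nu> l la, OF True]
    let ?w = "\<lambda>P. \<Prod>k<length la. branch q (la ! k) (P k) (P (Suc k))"
    have IH: "finite (patterns la \<kappa>)" "pattern_sum q la \<kappa> = (\<Sum>P\<in>patterns la \<kappa>. ?w P)" if "\<kappa> \<in> interlaced \<nu>" for \<kappa>
      using Cons.IH[of \<kappa>] Cons.prems shape_interlaced[OF _ that] by auto
    have "finite (Sigma (interlaced \<nu>) (patterns la))"
      using IH finite_interlaced[OF Cons.prems(2)] by (intro finite_SigmaI) auto
    then have fin: "finite (patterns (l # la) \<nu>)" using bij_betw_finite[OF bij] by simp
    have "pattern_sum q (l # la) \<nu> = (\<Sum>\<kappa>\<in>interlaced \<nu>. \<Sum>P\<in>patterns la \<kappa>. branch q l \<nu> \<kappa> * ?w P)"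
      using IH by (simp add: transfer_def sum_distrib_left)
    also have "\<dots> = (\<Sum>(\<kappa>, P)\<in>Sigma (interlaced \<nu>) (patterns la). branch q l \<nu> \<kappa> * ?w P)"
      by (rule sum.Sigma) (use IH finite_interlaced[OF Cons.prems(2)] in auto)
    also have "\<dots> = (\<Sum>x\<in>Sigma (interlaced \<nu>) (patterns la).
        (\<lambda>P. \<Prod>k<length (l # la). branch q ((l # la) ! k) (P k) (P (Suc k))) ((\<lambda>(\<kappa>, P). case_nat \<nu> P) x))"
    proof (rule sum.cong[OF refl])
      fix x assume "x \<in> Sigma (interlaced \<nu>) (patterns la)"
      then obtain \<kappa> P where x: "x = (\<kappa>, P)" "P \<in> patterns la \<kappa>" by auto
      then have "P 0 = \<kappa>" by (simp add: patterns_def)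
      then show "(case x of (\<kappa>, P) \<Rightarrow> branch q l \<nu> \<kappa> * ?w P) =
        (\<Prod>k<length (l # la). branch q ((l # la) ! k) ((case x of (\<kappa>, P) \<Rightarrow> case_nat \<nu> P) k) ((case x of (\<kappa>, P) \<Rightarrow> case_nat \<nu> P) (Suc k)))"
        unfolding x by (simp add: prod.lessThan_Suc_shift del: prod.lessThan_Suc)
    qed
    also have "\<dots> = (\<Sum>P\<in>patterns (l # la) \<nu>. \<Prod>k<length (l # la). branch q ((l # la) ! k) (P k) (P (Suc k)))"
      by (rule sum.reindex_bij_betw[OF bij])
    finally show ?thesis using fin by blast
  qed
qed

section \<open>Patterns as diagrams\<close>

definition row_shape :: "nat list \<Rightarrow> nat \<Rightarrow> nat" where
  "row_shape la i = part la (Suc i)"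

text \<open>With \<open>c = j - d\<close>, cell \<open>(r, j)\<close> belongs to the diagram if \<open>P (r - 1) i - i \<le> c < P r (i - 1) - i\<close> for
some \<open>i\<close>, where the upper bound is absent for \<open>i = 0\<close>. Moving all negative terms to the other side keeps
the condition within the natural numbers.\<close>

definition pattern_diagram :: "nat list \<Rightarrow> (nat \<Rightarrow> nat \<Rightarrow> nat) \<Rightarrow> cell set" where
  "pattern_diagram la P = {(r, j) \<in> shifted (length la) la.
     \<exists>i. P (r - 1) i + length la \<le> j + i \<and> (i = 0 \<or> j + i < P r (i - 1) + length la)}"

text \<open>If the cells of \<open>\<mu>\<close> are labelled by the row of the diagram in which the chain drops them, then the
cells of column \<open>t\<close> give the broken diagonal \<open>t\<close>: a cell in row \<open>i\<close> (from \<open>0\<close>) and column \<open>t\<close> sits in the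
column \<open>j\<close> of the diagram for which \<open>j - d\<close> is its content \<open>t - 1 - i\<close>.\<close>

definition pattern_diag :: "nat list \<Rightarrow> (nat \<Rightarrow> nat \<Rightarrow> nat) \<Rightarrow> nat \<Rightarrow> cell set" where
  "pattern_diag la P t = {(r, j). 1 \<le> r \<and> r \<le> length la \<and>
     (\<exists>i. j + i + 1 = length la + t \<and> P r i < t \<and> t \<le> P (r - 1) i)}"

text \<open>The effect of a reverse excited move on the chain.\<close>

definition bump :: "(nat \<Rightarrow> nat \<Rightarrow> nat) \<Rightarrow> nat \<Rightarrow> nat \<Rightarrow> nat \<Rightarrow> nat \<Rightarrow> nat" where
  "bump P k a = P(k := (P k)(a := Suc (P k a)))"

lemma bump_pred: "0 < k \<Longrightarrow> bump P k a (k - 1) = P (k - 1)"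
  by (cases k) (auto simp: bump_def)

lemma shape_row_shape:
  assumes "is_partition la"
  shows "shape (row_shape la)"
proof (rule shapeI[of _ "length la"]; (intro allI impI)?)
  fix i
  have "sorted_wrt (\<ge>) la" using assms by (simp add: is_partition_def)
  then have "la ! Suc i \<le> la ! i" if "Suc i < length la"
    using that sorted_wrt_nth_less[of "(\<ge>)" la i "Suc i"] by simp
  then show "row_shape la (Suc i) \<le> row_shape la i"
    by (auto simp: row_shape_def part_def)
qed (simp add: row_shape_def part_def)

lemma shifted_iff:
  "(r, j) \<in> shifted (length la) la \<longleftrightarrow> 1 \<le> r \<and> r \<le> length la \<and> r \<le> j \<and> j < part la r + length la"
  by (auto simp: shifted_def)

locale contained_partitions =
  fixes la mu :: "nat list"
  assumes la: "is_partition la" and mu: "is_partition mu" and sub: "diagram mu \<subseteq> diagram la"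
begin

abbreviation "d \<equiv> length la"

abbreviation "\<mu> \<equiv> row_shape mu"

lemma la_anti: "i \<le> j \<Longrightarrow> part la (Suc j) \<le> part la (Suc i)"
  using shape_antimono[OF shape_row_shape[OF la]] by (simp add: row_shape_def)

lemma mu_anti: "i \<le> j \<Longrightarrow> \<mu> j \<le> \<mu> i"
  by (rule shape_antimono[OF shape_row_shape[OF mu]])

lemma mu_le: "\<mu> i \<le> part la (Suc i)"
proof (cases "\<mu> i = 0")
  case False
  then have "(Suc i, \<mu> i) \<in> diagram mu" by (auto simp: diagram_def row_shape_def part_def split: if_splits)
  then show ?thesis using sub by (auto simp: diagram_def)
qed simp

context
  fixes P
  assumes P: "P \<in> patterns la \<mu>"
begin

lemma pattern_first: "P 0 = \<mu>" using P by (simp add: patterns_def)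

lemma pattern_le: "P (Suc k) i \<le> P k i" using P by (simp add: patterns_def interlaced_def)

lemma pattern_ge: "P k (Suc i) \<le> P (Suc k) i" using P by (simp add: patterns_def interlaced_def)

lemma pattern_first_row_bound: "P k 0 \<le> part la (Suc k)" using P by (simp add: patterns_def)

lemma pattern_antimono: "i \<le> i' \<Longrightarrow> P k i' \<le> P k i"
  by (rule shape_antimono[OF patterns_shape[OF P shape_row_shape[OF mu]]])

text \<open>Interlacing bounds row \<open>i\<close> of \<open>P k\<close> by the first row of \<open>P (k + i)\<close>.\<close>

lemma pattern_entry_bound: "P k i \<le> part la (Suc (k + i))"
proof (induction i arbitrary: k)
  case (Suc i)
  show ?case using pattern_ge[of k i] Suc.IH[of "Suc k"] by simp
qed (simp add: pattern_first_row_bound)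

lemma pattern_support: "0 < P k i \<Longrightarrow> k + i < d"
  using pattern_entry_bound[of k i] by (auto simp: part_def split: if_splits)

lemma pattern_le_top: "P k i \<le> \<mu> 0"
proof -
  have "P k i \<le> P k 0" by (rule pattern_antimono) simp
  also have "P k 0 \<le> P 0 0"
    by (induction k) (auto intro: order_trans[OF pattern_le])
  finally show ?thesis by (simp add: pattern_first)
qed

lemma pattern_row_bound: "P k i \<le> part la (Suc k)"
  using pattern_antimono[of 0 i k] pattern_first_row_bound[of k] by simp

text \<open>The cell of row \<open>k + 1\<close> just before the strip in row \<open>i\<close> separates two runs and is never in the diagram.\<close>

lemma separating_cell_notin:
  assumes "j + i + 1 = P (Suc k) i + d"
  shows "(Suc k, j) \<notin> pattern_diagram la P"
proof
  assume "(Suc k, j) \<in> pattern_diagram la P"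
  then obtain i' where i': "P k i' + d \<le> j + i'" "i' = 0 \<or> j + i' < P (Suc k) (i' - 1) + d"
    by (auto simp: pattern_diagram_def)
  show False
  proof (cases "i' \<le> i")
    case True
    then show False using pattern_antimono[of i' i k] pattern_le[of k i] i' assms by linarith
  next
    case False
    then show False using pattern_antimono[of i "i' - 1" "Suc k"] i' assms by linarith
  qed
qed

lemma pattern_diag_empty:
  assumes "t \<notin> {1..part mu 1}"
  shows "pattern_diag la P t = {}"
proof -
  have "\<not> (t \<le> P k i)" if "0 < t" for k i
    using pattern_le_top[of k i] assms that by (auto simp: row_shape_def)
  moreover have "\<not> P k i < t" if "t = 0" for k i using that by simp
  ultimately show ?thesis unfolding pattern_diag_def by (cases t) auto
qed

end

text \<open>Knowing \<open>P k\<close>, the shape \<open>P (k + 1)\<close> can be read off row \<open>k + 1\<close>: if two candidates differ in row \<open>i\<close>,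
the separating cell of the smaller one lies in the diagram of the larger one.\<close>

lemma pattern_inject:
  assumes P: "P \<in> patterns la \<mu>" and Q: "Q \<in> patterns la \<mu>"
    and eq: "pattern_diagram la P = pattern_diagram la Q"
  shows "P = Q"
proof -
  have half: "Q (Suc k) i \<le> P (Suc k) i"
    if P: "P \<in> patterns la \<mu>" and Q: "Q \<in> patterns la \<mu>" and eq: "pattern_diagram la P = pattern_diagram la Q"
      and k: "P k = Q k" for P Q k i
  proof (rule ccontr)
    assume "\<not> Q (Suc k) i \<le> P (Suc k) i"
    then have lt: "P (Suc k) i < Q (Suc k) i" by simp
    then have kd: "Suc k + i < d" using pattern_support[OF Q] by (metis not_gr_zero not_less_zero)
    define j where "j = P (Suc k) i + d - i - 1"
    have j: "j + i + 1 = P (Suc k) i + d" using kd by (simp add: j_def)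
    have "(Suc k, j) \<notin> pattern_diagram la P" by (rule separating_cell_notin[OF P j])
    moreover have "(Suc k, j) \<in> pattern_diagram la Q"
    proof -
      have "P (Suc k) i \<le> part la (Suc k)"
        using pattern_le[OF P, of k i] pattern_row_bound[OF P, of k i] by simp
      then have "(Suc k, j) \<in> shifted d la" unfolding shifted_iff using j kd by linarith
      moreover have "Q k (Suc i) + d \<le> j + Suc i" using pattern_ge[OF P, of k i] j k by simp
      ultimately show ?thesis unfolding pattern_diagram_def
        using lt j by (auto intro!: exI[of _ "Suc i"])
    qed
    ultimately show False using eq by simp
  qed
  have "P k = Q k" for k
  proof (induction k)
    case 0
    show ?case using pattern_first[OF P] pattern_first[OF Q] by simp
  next
    case (Suc k)
    show ?case using half[OF P Q eq Suc] half[OF Q P eq[symmetric] Suc[symmetric]] by (auto intro!: ext antisym)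
  qed
  then show ?thesis by blast
qed

lemma bump_fits:
  assumes P: "P \<in> patterns la \<mu>" and Q: "bump P k a \<in> patterns la \<mu>" and k: "0 < k"
  shows "Suc (P k a) \<le> P (k - 1) a" and "a = 0 \<or> Suc (P k a) \<le> P (Suc k) (a - 1)"
    and "a = 0 \<Longrightarrow> Suc (P k a) \<le> part la (Suc k)" and "k + a < d"
proof -
  show "Suc (P k a) \<le> P (k - 1) a" using pattern_le[OF Q, of "k - 1" a] k bump_pred[OF k, of P a] by (simp add: bump_def)
  show "a = 0 \<or> Suc (P k a) \<le> P (Suc k) (a - 1)" using pattern_ge[OF Q, of k "a - 1"]
    by (cases a) (auto simp: bump_def)
  show "a = 0 \<Longrightarrow> Suc (P k a) \<le> part la (Suc k)" using pattern_first_row_bound[OF Q, of k] by (auto simp: bump_def)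
  show "k + a < d" using pattern_support[OF Q, of k a] by (simp add: bump_def)
qed

context
  fixes P k a j
  assumes P: "P \<in> patterns la \<mu>" and Q: "bump P k a \<in> patterns la \<mu>" and k: "0 < k"
    and j: "j + a = P k a + d"
begin

lemma bump_cell_range: "k < j" "j < part la (Suc k) + d" "j < part la k + d"
proof -
  note B = bump_fits[OF P Q k]
  show "k < j" using B(4) j by linarith
  show 1: "j < part la (Suc k) + d"
    using B(3) pattern_row_bound[OF P, of k a] j by (cases "a = 0") auto
  have "part la (Suc k) \<le> part la k" using la_anti[of "k - 1" k] k by simp
  with 1 show "j < part la k + d" by simp
qed

text \<open>In row \<open>k\<close> the cell of column \<open>j\<close> is the first cell of a strip part and the cell to its left is a
separating cell, so neither is in the diagram. In row \<open>k + 1\<close> column \<open>j\<close> begins a run of the diagram.\<close>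

lemma bump_excitable: "rev_excitable (shifted d la) (pattern_diagram la P) (Suc k) j"
proof -
  note B = bump_fits[OF P Q k] and R = bump_cell_range
  have "(Suc k, j) \<in> pattern_diagram la P"
    unfolding pattern_diagram_def using B(2,4) R j
    by (auto simp: shifted_iff intro!: exI[of _ a])
  moreover have "(k, j - 1) \<in> shifted d la" "(k, j) \<in> shifted d la"
    using B(4) R k by (auto simp: shifted_iff)
  moreover have "(k, j - 1) \<notin> pattern_diagram la P"
    using separating_cell_notin[OF P, of "j - 1" a "k - 1"] j R k by simp
  moreover have "(k, j) \<notin> pattern_diagram la P"
  proof
    assume "(k, j) \<in> pattern_diagram la P"
    then obtain i where i: "P (k - 1) i + d \<le> j + i" "i = 0 \<or> j + i < P k (i - 1) + d"
      by (auto simp: pattern_diagram_def)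
    show False
    proof (cases "i \<le> a")
      case True
      then show False using pattern_antimono[OF P, of i a "k - 1"] B(1) i j by linarith
    next
      case False
      then show False using pattern_antimono[OF P, of a "i - 1" k] i j by linarith
    qed
  qed
  moreover have "(Suc k, j - 1) \<notin> pattern_diagram la P"
  proof
    assume "(Suc k, j - 1) \<in> pattern_diagram la P"
    then obtain i where i: "P k i + d \<le> j - 1 + i" "i = 0 \<or> j - 1 + i < P (Suc k) (i - 1) + d"
      by (auto simp: pattern_diagram_def)
    show False
    proof (cases "i \<le> a")
      case True
      then show False using pattern_antimono[OF P, of i a k] i j R(1) by linarith
    next
      case False
      then show False using pattern_antimono[OF P, of a "i - 1" "Suc k"] pattern_le[OF P, of k a] i j by linarith
    qed
  qed
  ultimately show ?thesis by (simp add: rev_excitable_def)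
qed

text \<open>Raising row \<open>a\<close> of \<open>P k\<close> removes the first cell of a run in row \<open>k + 1\<close>, and in row \<open>k\<close> prolongs the run
to the left of a separating cell by that cell. This is the move.\<close>

lemma bump_diagram: "pattern_diagram la (bump P k a) = rev_move (pattern_diagram la P) (Suc k) j"
proof -
  note B = bump_fits[OF P Q k] and R = bump_cell_range
  let ?Q = "bump P k a"
  let ?in = "\<lambda>P r j. \<exists>i. P (r - 1) i + d \<le> j + i \<and> (i = 0 \<or> j + i < P r (i - 1) + d)"
  have lower: "?in ?Q (Suc k) j' \<longleftrightarrow> ?in P (Suc k) j' \<and> j' \<noteq> j" for j'
  proof
    assume "?in ?Q (Suc k) j'"
    then obtain i where i: "?Q k i + d \<le> j' + i" "i = 0 \<or> j' + i < P (Suc k) (i - 1) + d"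
      by (auto simp: bump_def)
    have "P k i \<le> ?Q k i" by (simp add: bump_def)
    then have "?in P (Suc k) j'" using i by (auto intro!: exI[of _ i])
    moreover have "j' \<noteq> j"
    proof
      assume jj: "j' = j"
      consider "i < a" | "i = a" | "a < i" by linarith
      then show False
      proof cases
        case 1
        then show False using pattern_antimono[OF P, of i a k] \<open>P k i \<le> ?Q k i\<close> i j jj by linarith
      next
        case 2
        then show False using i j jj by (simp add: bump_def)
      next
        case 3
        then show False using pattern_antimono[OF P, of a "i - 1" "Suc k"] pattern_le[OF P, of k a] i j jj by linarith
      qed
    qed
    ultimately show "?in P (Suc k) j' \<and> j' \<noteq> j" by blast
  next
    assume "?in P (Suc k) j' \<and> j' \<noteq> j"
    then obtain i where i: "P k i + d \<le> j' + i" "i = 0 \<or> j' + i < P (Suc k) (i - 1) + d" "j' \<noteq> j"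
      by auto
    then have "?Q k i + d \<le> j' + i" using j by (cases "i = a") (auto simp: bump_def)
    then show "?in ?Q (Suc k) j'" using i by (auto simp: bump_def intro!: exI[of _ i])
  qed
  have upper: "?in ?Q k j' \<longleftrightarrow> ?in P k j' \<or> j' = j - 1" for j'
  proof
    assume "?in ?Q k j'"
    then obtain i where i: "P (k - 1) i + d \<le> j' + i" "i = 0 \<or> j' + i < ?Q k (i - 1) + d"
      unfolding bump_pred[OF k] by blast
    show "?in P k j' \<or> j' = j - 1"
    proof (cases "i = 0 \<or> j' + i < P k (i - 1) + d")
      case True
      then show ?thesis using i by blast
    next
      case False
      then have "i - 1 = a" "j' + i < Suc (P k a) + d" using i by (auto simp: bump_def split: if_splits)
      with False j have "j' = j - 1" by auto
      then show ?thesis by blast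
    qed
  next
    assume "?in P k j' \<or> j' = j - 1"
    then show "?in ?Q k j'"
    proof
      assume "?in P k j'"
      then obtain i where i: "P (k - 1) i + d \<le> j' + i" "i = 0 \<or> j' + i < P k (i - 1) + d" by auto
      have "P k (i - 1) \<le> ?Q k (i - 1)" by (simp add: bump_def)
      then show ?thesis using i k by (auto simp: bump_def intro!: exI[of _ i])
    next
      assume jj: "j' = j - 1"
      have "P (k - 1) (Suc a) \<le> P k a" using pattern_ge[OF P, of "k - 1" a] k by simp
      then show ?thesis using jj j R(1) k by (auto simp: bump_def intro!: exI[of _ "Suc a"])
    qed
  qed
  show ?thesis
  proof (rule set_eqI, clarify)
    fix r j'
    consider "r = Suc k" | "r = k" | "r \<noteq> Suc k" "r \<noteq> k" by blast
    then show "(r, j') \<in> pattern_diagram la ?Q \<longleftrightarrow> (r, j') \<in> rev_move (pattern_diagram la P) (Suc k) j"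
    proof cases
      case 1
      then show ?thesis using lower[of j'] by (auto simp: pattern_diagram_def rev_move_def)
    next
      case 2
      have "(k, j - 1) \<in> shifted d la" using B(4) R k by (auto simp: shifted_iff)
      then show ?thesis using upper[of j'] 2 by (auto simp: pattern_diagram_def rev_move_def)
    next
      case 3
      then have "?Q r = P r" "1 \<le> r \<Longrightarrow> ?Q (r - 1) = P (r - 1)" by (auto simp: bump_def)
      then show ?thesis using 3
        by (cases "1 \<le> r") (simp_all add: pattern_diagram_def rev_move_def shifted_iff)
    qed
  qed
qed

text \<open>The added cell of \<open>P k\<close> was previously dropped in row \<open>k\<close> and is now dropped in row \<open>k + 1\<close>, in the same
column of the diagram; all other cells keep their rows.\<close>

lemma bump_diag:
  "pattern_diag la (bump P k a) =
    (pattern_diag la P)(Suc (P k a) := insert (Suc k, j) (pattern_diag la P (Suc (P k a)) - {(k, j)}))"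
proof (rule ext, rule set_eqI, clarify)
  note B = bump_fits[OF P Q k]
  fix t r j'
  let ?Q = "bump P k a" and ?t = "Suc (P k a)"
  let ?rhs = "((pattern_diag la P)(?t := insert (Suc k, j) (pattern_diag la P ?t - {(k, j)}))) t"
  consider "r = Suc k" | "r = k" | "r \<noteq> Suc k" "r \<noteq> k" by blast
  then show "(r, j') \<in> pattern_diag la ?Q t \<longleftrightarrow> (r, j') \<in> ?rhs"
  proof cases
    case 1
    have "(\<exists>i. j' + i + 1 = d + t \<and> P (Suc k) i < t \<and> t \<le> ?Q k i) \<longleftrightarrow>
      (\<exists>i. j' + i + 1 = d + t \<and> P (Suc k) i < t \<and> t \<le> P k i) \<or> (t = ?t \<and> j' = j)"
    proof
      assume "\<exists>i. j' + i + 1 = d + t \<and> P (Suc k) i < t \<and> t \<le> ?Q k i"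
      then obtain i where i: "j' + i + 1 = d + t" "P (Suc k) i < t" "t \<le> ?Q k i" by blast
      show "(\<exists>i. j' + i + 1 = d + t \<and> P (Suc k) i < t \<and> t \<le> P k i) \<or> (t = ?t \<and> j' = j)"
      proof (cases "t \<le> P k i")
        case False
        then have "i = a" "t = ?t" using i(3) by (auto simp: bump_def split: if_splits)
        then show ?thesis using i(1) j by auto
      qed (use i in blast)
    next
      assume "(\<exists>i. j' + i + 1 = d + t \<and> P (Suc k) i < t \<and> t \<le> P k i) \<or> (t = ?t \<and> j' = j)"
      then show "\<exists>i. j' + i + 1 = d + t \<and> P (Suc k) i < t \<and> t \<le> ?Q k i"
      proof
        assume "\<exists>i. j' + i + 1 = d + t \<and> P (Suc k) i < t \<and> t \<le> P k i"
        then obtain i where i: "j' + i + 1 = d + t" "P (Suc k) i < t" "t \<le> P k i" by blast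
        then have "t \<le> ?Q k i" by (auto simp: bump_def)
        with i show ?thesis by blast
      next
        assume "t = ?t \<and> j' = j"
        then show ?thesis using j pattern_le[OF P, of k a] by (auto simp: bump_def intro!: exI[of _ a])
      qed
    qed
    moreover have "?Q (Suc k) = P (Suc k)" by (simp add: bump_def)
    moreover have "Suc k \<le> d" using B(4) by simp
    ultimately show ?thesis using 1 by (auto simp: pattern_diag_def)
  next
    case 2
    have "(\<exists>i. j' + i + 1 = d + t \<and> ?Q k i < t \<and> t \<le> P (k - 1) i) \<longleftrightarrow>
      (\<exists>i. j' + i + 1 = d + t \<and> P k i < t \<and> t \<le> P (k - 1) i) \<and> \<not> (t = ?t \<and> j' = j)"
    proof
      assume "\<exists>i. j' + i + 1 = d + t \<and> ?Q k i < t \<and> t \<le> P (k - 1) i"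
      then obtain i where i: "j' + i + 1 = d + t" "?Q k i < t" "t \<le> P (k - 1) i" by blast
      moreover from i have "P k i < t" by (auto simp: bump_def split: if_splits)
      moreover have "\<not> (t = ?t \<and> j' = j)"
      proof
        assume "t = ?t \<and> j' = j"
        then have "i = a" "t = ?t" using i(1) j by auto
        then show False using i(2) by (simp add: bump_def)
      qed
      ultimately show "(\<exists>i. j' + i + 1 = d + t \<and> P k i < t \<and> t \<le> P (k - 1) i) \<and> \<not> (t = ?t \<and> j' = j)"
        by blast
    next
      assume "(\<exists>i. j' + i + 1 = d + t \<and> P k i < t \<and> t \<le> P (k - 1) i) \<and> \<not> (t = ?t \<and> j' = j)"
      then obtain i where i: "j' + i + 1 = d + t" "P k i < t" "t \<le> P (k - 1) i" "\<not> (t = ?t \<and> j' = j)" by blast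
      have "?Q k i < t"
      proof (rule ccontr)
        assume "\<not> ?Q k i < t"
        then have "i = a" "t = ?t" using i(2) by (auto simp: bump_def split: if_splits)
        then show False using i(1,4) j by auto
      qed
      with i show "\<exists>i. j' + i + 1 = d + t \<and> ?Q k i < t \<and> t \<le> P (k - 1) i" by blast
    qed
    moreover have "?Q (k - 1) = P (k - 1)" by (rule bump_pred[OF k])
    ultimately show ?thesis using 2 by (auto simp: pattern_diag_def)
  next
    case 3
    then have "?Q r = P r" "1 \<le> r \<Longrightarrow> ?Q (r - 1) = P (r - 1)" by (auto simp: bump_def)
    then show ?thesis using 3 by (auto simp: pattern_diag_def)
  qed
qed

lemma bump_diag_index: "(k, j) \<in> pattern_diag la P t \<longleftrightarrow> t = Suc (P k a)"
proof
  assume "(k, j) \<in> pattern_diag la P t"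
  then obtain i where i: "j + i + 1 = d + t" "P k i < t" "t \<le> P (k - 1) i"
    by (auto simp: pattern_diag_def)
  consider "i < a" | "i = a" | "a < i" by linarith
  then show "t = Suc (P k a)"
  proof cases
    case 1
    then show ?thesis using pattern_antimono[OF P, of i a k] i j by linarith
  next
    case 2
    then show ?thesis using i j by linarith
  next
    case 3
    have "P (k - 1) (Suc a) \<le> P k a" using pattern_ge[OF P, of "k - 1" a] k by simp
    with 3 show ?thesis using pattern_antimono[OF P, of "Suc a" i "k - 1"] i j by linarith
  qed
next
  note B = bump_fits[OF P Q k]
  assume "t = Suc (P k a)"
  then show "(k, j) \<in> pattern_diag la P t"
    using B(1,4) j k by (auto simp: pattern_diag_def intro!: exI[of _ a])
qed

lemma bump_diag_range: "Suc (P k a) \<in> {1..part mu 1}"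
  using bump_fits(1)[OF P Q k] pattern_le_top[OF P, of "k - 1" a] by (simp add: row_shape_def)

end

end

context contained_partitions
begin

text \<open>Conversely, since \<open>(r, j)\<close> begins a run in row \<open>r\<close>, its column determines a row \<open>a\<close> of \<open>P (r - 1)\<close>. For
the raised row the conditions on row \<open>r - 1\<close> of the diagram give the interlacing inequality with the
preceding shape, and the run being nonempty gives the one with the following shape.\<close>

lemma excitable_is_bump:
  assumes P: "P \<in> patterns la \<mu>" and ex: "rev_excitable (shifted d la) (pattern_diagram la P) r j"
  obtains k a where "0 < k" "r = Suc k" "j + a = P k a + d" "bump P k a \<in> patterns la \<mu>"
proof -
  let ?in = "\<lambda>r j. \<exists>i. P (r - 1) i + d \<le> j + i \<and> (i = 0 \<or> j + i < P r (i - 1) + d)"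
  define k where "k = r - 1"
  have L: "(r, j) \<in> shifted d la" "(r - 1, j - 1) \<in> shifted d la" "(r - 1, j) \<in> shifted d la"
    and D: "(r, j) \<in> pattern_diagram la P" "(r - 1, j - 1) \<notin> pattern_diagram la P"
      "(r - 1, j) \<notin> pattern_diagram la P" "(r, j - 1) \<notin> pattern_diagram la P"
    using ex by (auto simp: rev_excitable_def pattern_diagram_def)
  have k: "0 < k" "r = Suc k" using L(2) by (auto simp: shifted_iff k_def)
  have j: "k < j" "j < part la (Suc k) + d" "Suc k \<le> d" using L(1) k by (auto simp: shifted_iff)
  obtain a where a: "P k a + d \<le> j + a" "a = 0 \<or> j + a < P (Suc k) (a - 1) + d"
    using D(1) k by (auto simp: pattern_diagram_def)
  have eq: "j + a = P k a + d"
  proof (cases "j = Suc k")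
    case True
    have "Suc k + a \<le> d"
    proof (cases "a = 0")
      case False
      show ?thesis
      proof (rule ccontr)
        assume "\<not> Suc k + a \<le> d"
        then have "P (Suc k) (a - 1) = 0" using pattern_support[OF P, of "Suc k" "a - 1"] False by auto
        then show False using a False True \<open>\<not> Suc k + a \<le> d\<close> by simp
      qed
    qed (use j in simp)
    then show ?thesis using a True by linarith
  next
    case False
    then have "(r, j - 1) \<in> shifted d la" using j k by (auto simp: shifted_iff)
    then have "\<not> ?in r (j - 1)" using D(4) by (auto simp: pattern_diagram_def)
    then have "\<not> (P k a + d \<le> j - 1 + a \<and> (a = 0 \<or> j - 1 + a < P (Suc k) (a - 1) + d))"
      using k by auto
    then show ?thesis using a j by auto
  qed
  have up: "Suc (P k a) \<le> P (k - 1) a"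
  proof (rule ccontr)
    assume n: "\<not> Suc (P k a) \<le> P (k - 1) a"
    have "\<not> ?in k j" using D(3) L(3) k by (simp add: pattern_diagram_def)
    then have "\<not> (P (k - 1) a + d \<le> j + a \<and> (a = 0 \<or> j + a < P k (a - 1) + d))" by blast
    then have "a \<noteq> 0" "P k (a - 1) \<le> P k a" using n eq by auto
    then show False using a eq pattern_le[OF P, of k "a - 1"] by simp
  qed
  let ?Q = "bump P k a"
  have Qk: "?Q k i = (if i = a then Suc (P k a) else P k i)" for i by (simp add: bump_def)
  have Qo: "?Q k' = P k'" if "k' \<noteq> k" for k' using that by (simp add: bump_def)
  have "?Q \<in> patterns la \<mu>"
    unfolding patterns_def
  proof (intro CollectI conjI allI)
    show "?Q 0 = \<mu>" using Qo[of 0] k pattern_first[OF P] by simp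
  next
    fix k'
    have pb: "P (Suc k') \<in> interlaced (P k')" using P by (simp add: patterns_def)
    consider "k' = k" | "Suc k' = k" | "k' \<noteq> k" "Suc k' \<noteq> k" by blast
    then show "?Q (Suc k') \<in> interlaced (?Q k')"
    proof cases
      case 1
      have "?Q k (Suc i) \<le> P (Suc k) i" for i
        using pattern_ge[OF P, of k i] a eq by (cases "Suc i = a") (auto simp: Qk)
      moreover have "P (Suc k) i \<le> ?Q k i" for i
        using pattern_le[OF P, of k i] by (auto simp: Qk)
      ultimately show ?thesis using 1 Qo[of "Suc k"] by (simp add: interlaced_def)
    next
      case 2
      have "?Q k i \<le> P k' i" for i
        using pattern_le[OF P, of k' i] up 2 by (auto simp: Qk)
      moreover have "P k' (Suc i) \<le> ?Q k i" for i
        using pattern_ge[OF P, of k' i] 2 by (auto simp: Qk)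
      ultimately show ?thesis using 2 Qo[of k'] by (auto simp: interlaced_def)
    next
      case 3
      then show ?thesis using pb Qo by simp
    qed
  next
    fix k'
    show "?Q k' 0 \<le> part la (Suc k')"
    proof (cases "k' = k \<and> a = 0")
      case True
      then have "?Q k' 0 = Suc (P k 0)" using Qk[of 0] by simp
      then show ?thesis using eq j True by simp
    next
      case False
      then show ?thesis using pattern_first_row_bound[OF P, of k'] by (auto simp: bump_def)
    qed
  qed
  then show thesis using that k eq by blast
qed

text \<open>The chain obtained by removing the first row again and again. It is the smallest one, as interlacing gives
\<open>P k i \<ge> P 0 (k + i)\<close>.\<close>

definition least_pattern :: "nat \<Rightarrow> nat \<Rightarrow> nat" where
  "least_pattern k i = \<mu> (k + i)"

lemma least_pattern_in: "least_pattern \<in> patterns la \<mu>"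
  using mu_le by (auto simp: patterns_def interlaced_def least_pattern_def fun_eq_iff intro: mu_anti)

lemma least_pattern_diagram: "pattern_diagram la least_pattern = shifted_skew la mu"
proof (rule set_eqI, clarify)
  fix r j
  have e: "(\<exists>i. least_pattern (r - 1) i + d \<le> j + i \<and> (i = 0 \<or> j + i < least_pattern r (i - 1) + d)) \<longleftrightarrow>
      part mu r + d \<le> j" if "1 \<le> r"
  proof -
    have "least_pattern r (i - 1) = least_pattern (r - 1) i" if "i \<noteq> 0" for i
      using that \<open>1 \<le> r\<close> by (simp add: least_pattern_def add.commute)
    moreover have "least_pattern (r - 1) 0 = part mu r"
      using that by (simp add: least_pattern_def row_shape_def)
    ultimately show ?thesis
      by (metis add.right_neutral not_less)
  qed
  show "(r, j) \<in> pattern_diagram la least_pattern \<longleftrightarrow> (r, j) \<in> shifted_skew la mu"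
  proof (cases "1 \<le> r")
    case True
    show ?thesis
      unfolding pattern_diagram_def shifted_skew_def mem_Collect_eq prod.case Diff_iff e[OF True]
      by (auto simp: shifted_def)
  qed (simp add: pattern_diagram_def shifted_skew_def shifted_def)
qed

lemma conj_part_iff:
  assumes "1 \<le> r" "1 \<le> t"
  shows "t \<le> part mu r \<longleftrightarrow> r \<le> conj_part mu t"
proof -
  let ?A = "{i. 1 \<le> i \<and> t \<le> part mu i \<and> i \<le> length mu}"
  have fin: "finite ?A" by (rule finite_subset[of _ "{..length mu}"]) auto
  have anti: "part mu i' \<le> part mu i" if "1 \<le> i" "i \<le> i'" for i i'
    using mu_anti[of "i - 1" "i' - 1"] that by (simp add: row_shape_def)
  show ?thesis
  proof
    assume t: "t \<le> part mu r"
    have "{1..r} \<subseteq> ?A"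
    proof
      fix i assume i: "i \<in> {1..r}"
      then have "t \<le> part mu i" using anti[of i r] t by simp
      moreover then have "i \<le> length mu" using assms by (auto simp: part_def split: if_splits)
      ultimately show "i \<in> ?A" using i by simp
    qed
    from card_mono[OF fin this] show "r \<le> conj_part mu t" by (simp add: conj_part_def)
  next
    assume r: "r \<le> conj_part mu t"
    show "t \<le> part mu r"
    proof (rule ccontr)
      assume n: "\<not> t \<le> part mu r"
      have "?A \<subseteq> {1..<r}"
      proof
        fix i assume i: "i \<in> ?A"
        then show "i \<in> {1..<r}" using anti[of r i] n assms by (cases "i < r") auto
      qed
      from card_mono[OF _ this] have "conj_part mu t \<le> r - 1" by (simp add: conj_part_def)
      with r assms show False by simp
    qed
  qed
qed

text \<open>The chain drops the cell of \<open>\<mu>\<close> in row \<open>i\<close> and column \<open>t\<close> in that row \<open>r\<close> of the diagram for which \<open>r + i\<close> is the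
length of the column, so that \<open>j - r\<close> is the same for all cells of the column.\<close>

lemma least_pattern_diag:
  assumes t: "1 \<le> t"
  shows "pattern_diag la least_pattern t = init_diag la mu t"
proof (rule set_eqI, clarify)
  fix r j
  let ?c = "conj_part mu t"
  have anti: "part mu i' \<le> part mu i" if "1 \<le> i" "i \<le> i'" for i i'
    using mu_anti[of "i - 1" "i' - 1"] that by (simp add: row_shape_def)
  have cd: "?c \<le> d"
  proof (rule ccontr)
    assume "\<not> ?c \<le> d"
    then have "t \<le> part mu (Suc d)" using conj_part_iff[of "Suc d" t] t by simp
    moreover have "part mu (Suc d) \<le> part la (Suc d)" using mu_le[of d] by (simp add: row_shape_def)
    ultimately show False using t by (simp add: part_def)
  qed
  have lp: "(least_pattern r i < t \<and> t \<le> least_pattern (r - 1) i) \<longleftrightarrow> r + i = ?c" if "1 \<le> r" for i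
  proof -
    have "least_pattern r i = part mu (Suc (r + i))" "least_pattern (r - 1) i = part mu (r + i)"
      using that by (simp_all add: least_pattern_def row_shape_def)
    then show ?thesis using conj_part_iff[of "Suc (r + i)" t] conj_part_iff[of "r + i" t] t that
      by (auto simp: not_le[symmetric])
  qed
  have "(r, j) \<in> pattern_diag la least_pattern t \<longleftrightarrow> 1 \<le> r \<and> r \<le> d \<and> (\<exists>i. j + i + 1 = d + t \<and> r + i = ?c)"
    unfolding pattern_diag_def using lp by (auto simp: conj_assoc)
  also have "\<dots> \<longleftrightarrow> 1 \<le> r \<and> r \<le> ?c \<and> j + ?c + 1 = r + d + t"
    using cd by (auto intro!: exI[of _ "?c - r"])
  also have "\<dots> \<longleftrightarrow> (r, j) \<in> init_diag la mu t"
  proof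
    assume a: "1 \<le> r \<and> r \<le> ?c \<and> j + ?c + 1 = r + d + t"
    then have "t \<le> part mu r" using conj_part_iff[of r t] t by simp
    moreover have "r \<le> j" using a cd t by linarith
    ultimately show "(r, j) \<in> init_diag la mu t"
      using a cd by (auto simp: init_diag_def shifted_def Defs.content_def)
  next
    assume a: "(r, j) \<in> init_diag la mu t"
    then have b: "1 \<le> r" "r \<le> d" "j \<le> part mu r + d - 1" "j + ?c + 1 = r + d + t"
      by (auto simp: init_diag_def shifted_def Defs.content_def)
    have "r \<le> ?c"
    proof (rule ccontr)
      assume n: "\<not> r \<le> ?c"
      then have "part mu r < t" using conj_part_iff[of r t] b t by simp
      with b n show False by linarith
    qed
    with b show "1 \<le> r \<and> r \<le> ?c \<and> j + ?c + 1 = r + d + t" by simp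
  qed
  finally show "(r, j) \<in> pattern_diag la least_pattern t \<longleftrightarrow> (r, j) \<in> init_diag la mu t" .
qed

lemma least_pattern_diags:
  "pattern_diag la least_pattern = (\<lambda>r. if r \<in> {1..part mu 1} then init_diag la mu r else {})"
  using pattern_diag_empty[OF least_pattern_in] least_pattern_diag by (auto simp: fun_eq_iff)

text \<open>In a chain that is not least, some \<open>P (k + 1) a\<close> exceeds its lower bound \<open>P k (a + 1)\<close>. For the largest
such \<open>k\<close> the next shape \<open>P (k + 2)\<close> is forced, hence too small to prevent \<open>P (k + 1) a\<close> from being lowered.\<close>

lemma pattern_is_bump:
  assumes P: "P \<in> patterns la \<mu>" and ne: "P \<noteq> least_pattern"
  obtains Q k a where "Q \<in> patterns la \<mu>" "P = bump Q k a" "0 < k" "k < d" "a < d"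
proof -
  let ?K = "{k. \<exists>a. P k (Suc a) < P (Suc k) a}"
  have "\<exists>k. k \<in> ?K"
  proof (rule ccontr)
    assume "\<not> (\<exists>k. k \<in> ?K)"
    then have e: "P (Suc k) a = P k (Suc a)" for k a
      using pattern_ge[OF P, of k a] by (auto simp: not_less intro: antisym)
    have "P k a = least_pattern k a" for k a
    proof (induction k arbitrary: a)
      case 0 show ?case using pattern_first[OF P] by (simp add: least_pattern_def)
    next
      case (Suc k) then show ?case using e[of k a] by (simp add: least_pattern_def)
    qed
    then show False using ne by blast
  qed
  then obtain k0 where k0: "k0 \<in> ?K" by blast
  have bd: "k < d" if "k \<in> ?K" for k
  proof -
    from that obtain a where "0 < P (Suc k) a" by force
    from pattern_support[OF P this] show ?thesis by simp
  qed
  define k where "k = Max ?K"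
  have fin: "finite ?K" by (rule finite_subset[of _ "{..<d}"]) (use bd in auto)
  have kK: "k \<in> ?K" unfolding k_def by (rule Max_in[OF fin]) (use k0 in blast)
  have km: "Suc k \<notin> ?K" using Max_ge[OF fin, of "Suc k"] by (auto simp: k_def)
  from kK obtain a where a: "P k (Suc a) < P (Suc k) a" by blast
  then have ad: "Suc k + a < d" using pattern_support[OF P, of "Suc k" a] by simp
  define Q where "Q = P(Suc k := (P (Suc k))(a := P (Suc k) a - 1))"
  have Qk: "Q (Suc k) i = (if i = a then P (Suc k) a - 1 else P (Suc k) i)" for i by (simp add: Q_def)
  have Qo: "Q k' = P k'" if "k' \<noteq> Suc k" for k' using that by (simp add: Q_def)
  have up: "P (Suc (Suc k)) a < P (Suc k) a"
  proof -
    have "P (Suc (Suc k)) a \<le> P (Suc k) (Suc a)" using km by (auto simp: not_less)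
    also have "\<dots> \<le> P k (Suc a)" by (rule pattern_le[OF P])
    finally show ?thesis using a by simp
  qed
  have "Q \<in> patterns la \<mu>"
    unfolding patterns_def
  proof (intro CollectI conjI allI)
    show "Q 0 = \<mu>" using Qo[of 0] pattern_first[OF P] by simp
  next
    fix k'
    consider "k' = Suc k" | "k' = k" | "k' \<noteq> k" "k' \<noteq> Suc k" by blast
    then show "Q (Suc k') \<in> interlaced (Q k')"
    proof cases
      case 1
      have "Q (Suc k) (Suc i) \<le> P (Suc (Suc k)) i" for i
        using pattern_ge[OF P, of "Suc k" i] by (auto simp: Qk)
      moreover have "P (Suc (Suc k)) i \<le> Q (Suc k) i" for i
        using pattern_le[OF P, of "Suc k" i] up by (auto simp: Qk)
      ultimately show ?thesis using 1 Qo[of "Suc (Suc k)"] by (simp add: interlaced_def)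
    next
      case 2
      have "Q (Suc k) i \<le> P k i" for i
        using pattern_le[OF P, of k i] by (auto simp: Qk)
      moreover have "P k (Suc i) \<le> Q (Suc k) i" for i
        using pattern_ge[OF P, of k i] a by (auto simp: Qk)
      ultimately show ?thesis using 2 Qo[of k] by (simp add: interlaced_def)
    next
      case 3
      then show ?thesis using P Qo by (simp add: patterns_def)
    qed
  next
    fix k'
    have "Q k' 0 \<le> P k' 0" by (simp add: Q_def)
    also have "\<dots> \<le> part la (Suc k')" by (rule pattern_first_row_bound[OF P])
    finally show "Q k' 0 \<le> part la (Suc k')" .
  qed
  moreover have "P = bump Q (Suc k) a"
    using up by (auto simp: bump_def Q_def fun_eq_iff)
  ultimately show thesis using that ad by auto
qed

text \<open>Induction on the number of cells in all shapes of the chain, undoing one move at a time.\<close>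

lemma pattern_reachable:
  "P \<in> patterns la \<mu> \<Longrightarrow> pattern_diagram la P \<in> RE la mu \<and> is_diags la mu (pattern_diagram la P) (pattern_diag la P)"
proof (induction "\<Sum>k<d. \<Sum>a<d. P k a" arbitrary: P rule: less_induct)
  case less
  note P = less.prems
  show ?case
  proof (cases "P = least_pattern")
    case True
    then show ?thesis unfolding True least_pattern_diagram least_pattern_diags
      by (blast intro: RE_init diags_init)
  next
    case False
    then obtain Q k a where Q: "Q \<in> patterns la \<mu>" "P = bump Q k a" "0 < k" "k < d" "a < d"
      using pattern_is_bump[OF P] by blast
    have "(\<Sum>k<d. \<Sum>a<d. Q k a) < (\<Sum>k<d. \<Sum>a<d. P k a)"
    proof (rule sum_strict_mono_ex1)
      show "\<forall>x\<in>{..<d}. (\<Sum>a<d. Q x a) \<le> (\<Sum>a<d. P x a)"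
        using Q(2) by (auto simp: bump_def intro!: sum_mono)
      have "(\<Sum>a<d. Q k a) < (\<Sum>a<d. P k a)"
      proof (rule sum_strict_mono_ex1)
        show "\<forall>x\<in>{..<d}. Q k x \<le> P k x" using Q(2) by (auto simp: bump_def)
        show "\<exists>x\<in>{..<d}. Q k x < P k x" using Q(2,5) by (intro bexI[of _ a]) (auto simp: bump_def)
      qed simp
      then show "\<exists>x\<in>{..<d}. (\<Sum>a<d. Q x a) < (\<Sum>a<d. P x a)" using Q(4) by blast
    qed simp
    from less.hyps[OF this Q(1)] have IH: "pattern_diagram la Q \<in> RE la mu"
      "is_diags la mu (pattern_diagram la Q) (pattern_diag la Q)" by auto
    have QP: "bump Q k a \<in> patterns la \<mu>" using P Q(2) by simp
    define j where "j = Q k a + d - a"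
    have j: "j + a = Q k a + d" using Q(5) by (simp add: j_def)
    note ex = bump_excitable[OF Q(1) QP Q(3) j]
    have "is_diags la mu (rev_move (pattern_diagram la Q) (Suc k) j)
      ((pattern_diag la Q)(Suc (Q k a) := insert (Suc k, j) (pattern_diag la Q (Suc (Q k a)) - {(Suc k - 1, j)})))"
      by (rule diags_step[OF IH(2) ex bump_diag_range[OF Q(1) QP Q(3) j]])
         (use bump_diag_index[OF Q(1) QP Q(3) j] in simp_all)
    then have "is_diags la mu (pattern_diagram la P) (pattern_diag la P)"
      unfolding Q(2) bump_diagram[OF Q(1) QP Q(3) j] bump_diag[OF Q(1) QP Q(3) j] by simp
    moreover have "pattern_diagram la P \<in> RE la mu"
      unfolding Q(2) bump_diagram[OF Q(1) QP Q(3) j] by (rule RE_step[OF IH(1) ex])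
    ultimately show ?thesis by blast
  qed
qed

lemma RE_pattern: "D \<in> RE la mu \<Longrightarrow> D \<in> pattern_diagram la ` patterns la \<mu>"
proof (induction rule: RE.induct)
  case RE_init
  show ?case using least_pattern_diagram least_pattern_in by (metis imageI)
next
  case (RE_step D i j)
  then obtain P where P: "P \<in> patterns la \<mu>" "D = pattern_diagram la P" by blast
  from excitable_is_bump[OF P(1)] RE_step(2) P(2) obtain k a where
    k: "0 < k" "i = Suc k" "j + a = P k a + d" "bump P k a \<in> patterns la \<mu>" by blast
  show ?case unfolding P(2) k(2) bump_diagram[OF P(1) k(4,1,3), symmetric] using k(4) by blast
qed

lemma RE_eq: "RE la mu = pattern_diagram la ` patterns la \<mu>"
  using RE_pattern pattern_reachable by blast

text \<open>The chain determines both the diagram and the broken diagonals, whatever sequence of moves is used.\<close>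

lemma is_diags_pattern:
  "is_diags la mu D \<delta> \<Longrightarrow> \<exists>P\<in>patterns la \<mu>. D = pattern_diagram la P \<and> \<delta> = pattern_diag la P"
proof (induction rule: is_diags.induct)
  case diags_init
  show ?case using least_pattern_diagram least_pattern_diags least_pattern_in by metis
next
  case (diags_step D \<delta> i j t)
  then obtain P where P: "P \<in> patterns la \<mu>" "D = pattern_diagram la P" "\<delta> = pattern_diag la P" by blast
  from excitable_is_bump[OF P(1)] diags_step(2) P(2) obtain k a where
    k: "0 < k" "i = Suc k" "j + a = P k a + d" "bump P k a \<in> patterns la \<mu>" by blast
  have t: "t = Suc (P k a)" using bump_diag_index[OF P(1) k(4,1,3)] diags_step(4) P(3) k(2) by simp
  show ?case
  proof (intro bexI[of _ "bump P k a"] conjI)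
    show "rev_move D i j = pattern_diagram la (bump P k a)"
      unfolding P(2) k(2) by (rule bump_diagram[OF P(1) k(4,1,3), symmetric])
    show "\<delta>(t := insert (i, j) (\<delta> t - {(i - 1, j)})) = pattern_diag la (bump P k a)"
      unfolding P(3) k(2) t bump_diag[OF P(1) k(4,1,3)] by simp
  qed (rule k(4))
qed

lemma broken_diag_pattern:
  assumes P: "P \<in> patterns la \<mu>"
  shows "broken_diag la mu (pattern_diagram la P) = pattern_diag la P"
  unfolding broken_diag_def
proof (rule the_equality)
  show "is_diags la mu (pattern_diagram la P) (pattern_diag la P)"
    using pattern_reachable[OF P] by blast
  fix \<delta> assume "is_diags la mu (pattern_diagram la P) \<delta>"
  then show "\<delta> = pattern_diag la P" using is_diags_pattern pattern_inject[OF P] by metis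
qed

end

section \<open>The weight of a pattern\<close>

lemma fps_to_fls_sum: "fps_to_fls (sum f A) = (\<Sum>x\<in>A. fps_to_fls (f x))"
  by (induction A rule: infinite_finite_induct) auto

lemma fps_to_fls_prod:
  fixes f :: "'b \<Rightarrow> 'a::comm_ring_1 fps"
  shows "fps_to_fls (prod f A) = (\<Prod>x\<in>A. fps_to_fls (f x))"
  by (induction A rule: infinite_finite_induct) (auto simp: fls_times_fps_to_fls)

context contained_partitions
begin

context
  fixes P
  assumes P: "P \<in> patterns la \<mu>"
begin

text \<open>The cells right of the diagram are the separating cells that are preceded by a nonempty run.\<close>

lemma F_pattern:
  "F la (pattern_diagram la P) = (\<lambda>(k, i). (Suc k, P (Suc k) i + d - i - 1)) `
     {(k, i). k < d \<and> P k (Suc i) < P (Suc k) i}"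
proof (intro set_eqI iffI)
  fix u assume u: "u \<in> F la (pattern_diagram la P)"
  obtain r j where rj: "u = (r, j)" by force
  from u rj have L: "(r, j) \<in> shifted d la" and nD: "(r, j) \<notin> pattern_diagram la P"
    and D: "(r, j - 1) \<in> pattern_diagram la P" by (auto simp: F_def)
  from L have r: "1 \<le> r" "r \<le> d" "r \<le> j" by (auto simp: shifted_iff)
  from D obtain i where i: "P (r - 1) i + d \<le> j - 1 + i" "i = 0 \<or> j - 1 + i < P r (i - 1) + d"
    by (auto simp: pattern_diagram_def)
  have "P (r - 1) i + d \<le> j + i" using i(1) by simp
  then have n: "\<not> (i = 0 \<or> j + i < P r (i - 1) + d)" using nD L by (auto simp: pattern_diagram_def)
  then obtain i' where i': "i = Suc i'" by (cases i) auto
  have eq: "j + i' + 1 = P r i' + d" using n i(2) i' r by auto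
  have "P (r - 1) (Suc i') < P r i'" using i(1) i' eq r by simp
  moreover have "u = (Suc (r - 1), P (Suc (r - 1)) i' + d - i' - 1)" using rj r eq by simp
  ultimately show "u \<in> (\<lambda>(k, i). (Suc k, P (Suc k) i + d - i - 1)) ` {(k, i). k < d \<and> P k (Suc i) < P (Suc k) i}"
    using r by (intro image_eqI[of _ _ "(r - 1, i')"]) auto
next
  fix u assume "u \<in> (\<lambda>(k, i). (Suc k, P (Suc k) i + d - i - 1)) ` {(k, i). k < d \<and> P k (Suc i) < P (Suc k) i}"
  then obtain k i where u: "u = (Suc k, P (Suc k) i + d - i - 1)" and k: "k < d" "P k (Suc i) < P (Suc k) i" by auto
  define j where "j = P (Suc k) i + d - i - 1"
  have kd: "Suc k + i < d" using pattern_support[OF P, of "Suc k" i] k by simp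
  have j: "j + i + 1 = P (Suc k) i + d" using kd by (simp add: j_def)
  have b: "P (Suc k) i \<le> part la (Suc k)" using pattern_le[OF P, of k i] pattern_row_bound[OF P, of k i] by simp
  have L: "(Suc k, j) \<in> shifted d la" "(Suc k, j - 1) \<in> shifted d la"
    unfolding shifted_iff using j kd b k by auto
  have "(Suc k, j - 1) \<in> pattern_diagram la P"
    using L k j kd by (auto simp: pattern_diagram_def intro!: exI[of _ "Suc i"])
  then show "u \<in> F la (pattern_diagram la P)"
    using L separating_cell_notin[OF P j] u by (auto simp: F_def j_def)
qed

text \<open>Triples of a row \<open>k + 1\<close> and a cell \<open>(i, s)\<close> of the strip that the chain drops there; \<open>s\<close> is the column
counted from \<open>0\<close>.\<close>

lemma B_pattern:
  "B la mu (pattern_diagram la P) = (\<lambda>(k, i, s). (Suc k, d + s - i)) `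
     (SIGMA k:{..<d}. SIGMA i:{i. 0 < P k i}. {P (Suc k) i..<P k i})"
proof (intro set_eqI iffI)
  fix u assume "u \<in> B la mu (pattern_diagram la P)"
  then obtain t where t: "u \<in> pattern_diag la P t" "1 \<le> t" by (auto simp: B_def broken_diag_pattern[OF P])
  then obtain r j i where u: "u = (r, j)" "1 \<le> r" "r \<le> d" "j + i + 1 = d + t" "P r i < t" "t \<le> P (r - 1) i"
    by (auto simp: pattern_diag_def)
  then show "u \<in> (\<lambda>(k, i, s). (Suc k, d + s - i)) ` (SIGMA k:{..<d}. SIGMA i:{i. 0 < P k i}. {P (Suc k) i..<P k i})"
    using t by (intro image_eqI[of _ _ "(r - 1, i, t - 1)"]) auto
next
  fix u assume "u \<in> (\<lambda>(k, i, s). (Suc k, d + s - i)) ` (SIGMA k:{..<d}. SIGMA i:{i. 0 < P k i}. {P (Suc k) i..<P k i})"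
  then obtain k i s where u: "u = (Suc k, d + s - i)" "k < d" "P (Suc k) i \<le> s" "s < P k i" by auto
  have "k + i < d" using pattern_support[OF P, of k i] u by simp
  then have "u \<in> pattern_diag la P (Suc s)"
    using u by (auto simp: pattern_diag_def intro!: exI[of _ i])
  moreover have "Suc s \<in> {1..part mu 1}" using u(4) pattern_le_top[OF P, of k i] by (simp add: row_shape_def)
  ultimately show "u \<in> B la mu (pattern_diagram la P)" by (auto simp: B_def broken_diag_pattern[OF P])
qed

text \<open>Separating cells of the same row are distinct because \<open>P (k + 1) i - i\<close> strictly decreases in \<open>i\<close>.\<close>

lemma inj_F: "inj_on (\<lambda>(k, i). (Suc k, P (Suc k) i + d - i - 1)) {(k, i). k < d \<and> P k (Suc i) < P (Suc k) i}"
proof (rule inj_onI)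
  fix x y
  assume xy: "x \<in> {(k, i). k < d \<and> P k (Suc i) < P (Suc k) i}" "y \<in> {(k, i). k < d \<and> P k (Suc i) < P (Suc k) i}"
    and "(\<lambda>(k, i). (Suc k, P (Suc k) i + d - i - 1)) x = (\<lambda>(k, i). (Suc k, P (Suc k) i + d - i - 1)) y"
  then obtain k i i' where x: "x = (k, i)" and y: "y = (k, i')"
    and eq: "P (Suc k) i + d - i - 1 = P (Suc k) i' + d - i' - 1" by auto
  from xy have a: "P k (Suc i) < P (Suc k) i" "P k (Suc i') < P (Suc k) i'" by (auto simp: x y)
  have "Suc k + i < d" "Suc k + i' < d" using pattern_support[OF P] a by (metis not_less_zero neq0_conv)+
  with eq have e: "P (Suc k) i + i' = P (Suc k) i' + i" by linarith
  have "i = i'"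
    using e pattern_antimono[OF P, of i i' "Suc k"] pattern_antimono[OF P, of i' i "Suc k"] by linarith
  then show "x = y" by (simp add: x y)
qed

text \<open>Cells of a horizontal strip have different contents.\<close>

lemma inj_B: "inj_on (\<lambda>(k, i, s). (Suc k, d + s - i))
    (SIGMA k:{..<d}. SIGMA i:{i. 0 < P k i}. {P (Suc k) i..<P k i})"
proof (rule inj_onI)
  let ?T = "SIGMA k:{..<d}. SIGMA i:{i. 0 < P k i}. {P (Suc k) i..<P k i}"
  fix x y
  assume xy: "x \<in> ?T" "y \<in> ?T"
    and "(\<lambda>(k, i, s). (Suc k, d + s - i)) x = (\<lambda>(k, i, s). (Suc k, d + s - i)) y"
  then obtain k i s i' s' where x: "x = (k, i, s)" and y: "y = (k, i', s')"
    and eq: "d + s - i = d + s' - i'" by auto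
  from xy have a: "s \<in> {P (Suc k) i..<P k i}" "s' \<in> {P (Suc k) i'..<P k i'}" "0 < P k i" "0 < P k i'"
    by (auto simp: x y)
  have "k + i < d" "k + i' < d" using pattern_support[OF P] a by blast+
  with eq have e: "s + i' = s' + i" by linarith
  have "\<not> i < i'"
    using e a pattern_ge[OF P, of k i] pattern_antimono[OF P, of "Suc i" i' k] by auto
  moreover have "\<not> i' < i"
    using e a pattern_ge[OF P, of k i'] pattern_antimono[OF P, of "Suc i'" i k] by auto
  ultimately have "i = i'" by simp
  with e show "x = y" by (simp add: x y)
qed

lemma pattern_weight:
  "fps_to_fls (fps_X ^ pstar la (pattern_diagram la P) *
      (\<Prod>u\<in>B la mu (pattern_diagram la P). (1 - fps_X ^ weight la u)))
   = (\<Prod>k<d. branch (fls_X :: rat fls) (la ! k) (P k) (P (Suc k)))"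
proof -
  let ?q = "fls_X :: rat fls"
  let ?I = "SIGMA k:{..<d}. {i. 0 < P k i}"
  let ?U = "{(k, i). k < d \<and> P k (Suc i) < P (Suc k) i}"
  let ?w = "\<lambda>(k, i). la ! k + i + 1 - P (Suc k) i"
  have fin: "finite {i. 0 < P k i}" for k
    using patterns_shape[OF P shape_row_shape[OF mu]] by (simp add: shape_def)
  have part: "part la (Suc k) = la ! k" if "k < d" for k using that by (simp add: part_def)
  have le: "P k i \<le> la ! k" if "k < d" for k i using pattern_row_bound[OF P, of k i] part[OF that] by simp
  have strip: "strip ?q (la ! k) i (P k i) (P (Suc k) i) = (\<Prod>s = P (Suc k) i..<P k i. 1 - ?q ^ (la ! k + i - s))"
    if "k < d" for k i
    unfolding strip_def using pattern_le[OF P, of k i] le[OF that, of i]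
    by (auto intro!: prod.cong simp: power_diff)
  have turn: "turn ?q (la ! k) i (P (Suc k) i) (P k (Suc i)) = (if P k (Suc i) < P (Suc k) i then ?q ^ ?w (k, i) else 1)"
    if "k < d" for k i
  proof -
    have "P (Suc k) i \<le> la ! k" using pattern_le[OF P, of k i] le[OF that, of i] by simp
    then have "?q ^ (la ! k + i + 1 - P (Suc k) i) = ?q ^ Suc (la ! k + i) / ?q ^ P (Suc k) i"
      using power_diff[of ?q "P (Suc k) i" "la ! k + i + 1"] by simp
    then show ?thesis using pattern_ge[OF P, of k i] by (simp add: turn_def)
  qed
  have UI: "?U \<subseteq> ?I"
  proof
    fix x assume "x \<in> ?U"
    then obtain k i where "x = (k, i)" "k < d" "P k (Suc i) < P (Suc k) i" by blast
    then show "x \<in> ?I" using pattern_le[OF P, of k i] by simp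
  qed
  have "pstar la (pattern_diagram la P) = (\<Sum>x\<in>?U. ?w x)"
    unfolding pstar_def F_pattern sum.reindex[OF inj_F]
  proof (rule sum.cong[OF refl])
    fix x assume "x \<in> ?U"
    then obtain k i where x: "x = (k, i)" and a: "k < d" "P k (Suc i) < P (Suc k) i" by blast
    have "Suc k + i < d" using pattern_support[OF P, of "Suc k" i] a by simp
    then show "(weight la \<circ> (\<lambda>(k, i). (Suc k, P (Suc k) i + d - i - 1))) x = ?w x"
      unfolding x using part[OF a(1)] by (simp add: weight_def)
  qed
  then have "fps_to_fls (fps_X ^ pstar la (pattern_diagram la P)) = (\<Prod>x\<in>?U. ?q ^ ?w x)"
    by (simp only: power_sum fps_to_fls_prod fps_to_fls_power fps_X_to_fls)
  also have "\<dots> = (\<Prod>(k, i)\<in>?I. if P k (Suc i) < P (Suc k) i then ?q ^ ?w (k, i) else 1)"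
  proof (rule prod.mono_neutral_cong_left)
    show "finite ?I" using fin by (intro finite_SigmaI) auto
    show "?U \<subseteq> ?I" by (rule UI)
  qed (auto split: if_splits)
  also have "\<dots> = (\<Prod>k<d. \<Prod>i | 0 < P k i. turn ?q (la ! k) i (P (Suc k) i) (P k (Suc i)))"
    using fin turn by (subst prod.Sigma[symmetric]) (auto intro!: prod.cong)
  finally have 1: "fps_to_fls (fps_X ^ pstar la (pattern_diagram la P)) = \<dots>" .
  have "(\<Prod>u\<in>B la mu (pattern_diagram la P). (1 - ?q ^ weight la u))
    = (\<Prod>(k, i, s)\<in>(SIGMA k:{..<d}. SIGMA i:{i. 0 < P k i}. {P (Suc k) i..<P k i}). 1 - ?q ^ (la ! k + i - s))"
    unfolding B_pattern prod.reindex[OF inj_B]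
  proof (rule prod.cong[OF refl])
    fix x assume "x \<in> (SIGMA k:{..<d}. SIGMA i:{i. 0 < P k i}. {P (Suc k) i..<P k i})"
    then obtain k i s where x: "x = (k, i, s)" and a: "k \<in> {..<d}" "0 < P k i" "s \<in> {P (Suc k) i..<P k i}" by blast
    have "k + i < d" using pattern_support[OF P, of k i] a by simp
    then have "weight la (Suc k, d + s - i) = la ! k + i - s"
      using part a(1) by (simp add: weight_def)
    then show "((\<lambda>u. 1 - ?q ^ weight la u) \<circ> (\<lambda>(k, i, s). (Suc k, d + s - i))) x
        = (case x of (k, i, s) \<Rightarrow> 1 - ?q ^ (la ! k + i - s))"
      by (simp add: x)
  qed
  also have "\<dots> = (\<Prod>k<d. \<Prod>i | 0 < P k i. \<Prod>s = P (Suc k) i..<P k i. 1 - ?q ^ (la ! k + i - s))"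
    using fin by (subst prod.Sigma[symmetric]; (subst prod.Sigma[symmetric])?) (auto intro!: prod.cong simp: prod.Sigma)
  also have "\<dots> = (\<Prod>k<d. \<Prod>i | 0 < P k i. strip ?q (la ! k) i (P k i) (P (Suc k) i))"
    using strip by (intro prod.cong refl) auto
  finally have 2: "fps_to_fls (\<Prod>u\<in>B la mu (pattern_diagram la P). (1 - fps_X ^ weight la u :: rat fps)) = \<dots>"
    by (simp add: fps_to_fls_prod fps_to_fls_power)
  show ?thesis
    unfolding fls_times_fps_to_fls 1 2 branch_def by (simp add: prod.distrib mult.commute)
qed

end

theorem RE_sum:
  "fps_to_fls (\<Sum>D\<in>RE la mu. fps_X ^ pstar la D * (\<Prod>u\<in>B la mu D. (1 - fps_X ^ weight la u)))
    = pattern_sum (fls_X :: rat fls) la \<mu>"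
proof -
  have inj: "inj_on (pattern_diagram la) (patterns la \<mu>)"
    by (rule inj_onI) (rule pattern_inject)
  have "sorted_wrt (\<ge>) la" using la by (simp add: is_partition_def)
  then have "pattern_sum (fls_X :: rat fls) la \<mu> = (\<Sum>P\<in>patterns la \<mu>. \<Prod>k<d. branch fls_X (la ! k) (P k) (P (Suc k)))"
    using pattern_sum_eq[of "fls_X :: rat fls" la \<mu>] shape_row_shape[OF mu] by simp
  then show ?thesis
    unfolding RE_eq fps_to_fls_sum sum.reindex[OF inj] by (simp add: pattern_weight cong: sum.cong)
qed

end

section \<open>Comparison with reverse plane partitions\<close>

definition skew_cells :: "nat list \<Rightarrow> (nat \<Rightarrow> nat) \<Rightarrow> cell set" where
  "skew_cells la \<nu> = {(r, j). 1 \<le> r \<and> r \<le> length la \<and> \<nu> (r - 1) < j \<and> j \<le> part la r}"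

lemma finite_skew_cells: "finite (skew_cells la \<nu>)"
  by (rule finite_subset[of _ "SIGMA r:{..length la}. {..part la r}"]) (auto simp: skew_cells_def)

lemma card_skew_cells:
  assumes "\<forall>i. \<nu> i \<le> part la (Suc i)"
  shows "card (skew_cells la \<nu>) + size_of \<nu> = sum_list la"
proof -
  have "skew_cells la \<nu> = map_prod Suc id ` (SIGMA i:{..<length la}. {\<nu> i<..la ! i})"
  proof (intro set_eqI iffI)
    fix u assume "u \<in> skew_cells la \<nu>"
    then obtain r j where "u = (r, j)" "1 \<le> r" "r \<le> length la" "\<nu> (r - 1) < j" "j \<le> part la r"
      by (auto simp: skew_cells_def)
    then show "u \<in> map_prod Suc id ` (SIGMA i:{..<length la}. {\<nu> i<..la ! i})"
      by (intro image_eqI[of _ _ "(r - 1, j)"]) (auto simp: part_def)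
  qed (auto simp: skew_cells_def part_def)
  moreover have "inj_on (map_prod Suc id) (SIGMA i:{..<length la}. {\<nu> i<..la ! i})"
    by (auto simp: inj_on_def)
  ultimately have "card (skew_cells la \<nu>) = card (SIGMA i:{..<length la}. {\<nu> i<..la ! i})"
    by (simp only: card_image)
  also have "\<dots> = (\<Sum>i<length la. la ! i - \<nu> i)" by simp
  finally have "card (skew_cells la \<nu>) + (\<Sum>i<length la. \<nu> i) = (\<Sum>i<length la. la ! i - \<nu> i + \<nu> i)"
    by (simp add: sum.distrib)
  also have "\<dots> = (\<Sum>i<length la. la ! i)"
  proof (rule sum.cong[OF refl])
    fix i assume "i \<in> {..<length la}"
    then show "la ! i - \<nu> i + \<nu> i = la ! i" using assms[rule_format, of i] by (simp add: part_def)
  qed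
  also have "\<dots> = sum_list la" by (simp add: sum_list_sum_nth atLeast0LessThan)
  also have "(\<Sum>i<length la. \<nu> i) = size_of \<nu>"
  proof (rule size_of_eq[symmetric], intro allI impI)
    fix i assume "length la \<le> i"
    then show "\<nu> i = 0" using assms[rule_format, of i] by (simp add: part_def)
  qed
  finally show ?thesis .
qed

definition corners :: "nat list \<Rightarrow> (nat \<Rightarrow> nat) \<Rightarrow> nat set" where
  "corners la \<nu> = {i \<in> addable \<nu>. \<nu> i < part la (Suc i)}"

lemma minimal_skew_cells:
  assumes la: "is_partition la" and sh: "shape \<nu>" and le: "\<forall>i. \<nu> i \<le> part la (Suc i)"
  shows "minimal_cells (skew_cells la \<nu>) = (\<lambda>i. (Suc i, Suc (\<nu> i))) ` corners la \<nu>"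
proof (intro set_eqI iffI)
  fix u assume u: "u \<in> minimal_cells (skew_cells la \<nu>)"
  obtain r j where rj: "u = (r, j)" by force
  define i where "i = r - 1"
  have uc: "(r, j) \<in> skew_cells la \<nu>" using u rj by (simp add: minimal_cells_def)
  then have i: "r = Suc i" "i < length la" "\<nu> i < j" "j \<le> part la r" by (auto simp: skew_cells_def i_def)
  have row: "j \<le> j'" if "(r, j') \<in> skew_cells la \<nu>" for j' using u rj that by (simp add: minimal_cells_def)
  have col: "r \<le> r'" if "(r', j) \<in> skew_cells la \<nu>" for r' using u rj that by (simp add: minimal_cells_def)
  have "(r, Suc (\<nu> i)) \<in> skew_cells la \<nu>" using i by (auto simp: skew_cells_def)
  from row[OF this] have j: "j = Suc (\<nu> i)" using i by simp
  have "i \<in> addable \<nu>"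
  proof (cases i)
    case (Suc k)
    have "(i, j) \<notin> skew_cells la \<nu>" using col[of i] i by auto
    moreover have "part la (Suc i) \<le> part la (Suc k)"
      using shape_antimono[OF shape_row_shape[OF la], of k i] Suc by (simp add: row_shape_def)
    ultimately have "j \<le> \<nu> k" using i Suc by (auto simp: skew_cells_def)
    then show ?thesis using j Suc by (simp add: addable_def)
  qed (simp add: addable_def)
  then show "u \<in> (\<lambda>i. (Suc i, Suc (\<nu> i))) ` corners la \<nu>"
    using i j rj by (auto simp: corners_def)
next
  fix u assume "u \<in> (\<lambda>i. (Suc i, Suc (\<nu> i))) ` corners la \<nu>"
  then obtain i where u: "u = (Suc i, Suc (\<nu> i))" and i: "i \<in> addable \<nu>" "\<nu> i < part la (Suc i)"
    by (auto simp: corners_def)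
  have "i < length la" using i(2) by (auto simp: part_def split: if_splits)
  then have "u \<in> skew_cells la \<nu>" using i(2) u by (simp add: skew_cells_def)
  moreover have "Suc (\<nu> i) \<le> j'" if "(Suc i, j') \<in> skew_cells la \<nu>" for j'
    using that by (simp add: skew_cells_def)
  moreover have "Suc i \<le> r'" if c: "(r', Suc (\<nu> i)) \<in> skew_cells la \<nu>" for r'
  proof (rule ccontr)
    assume n: "\<not> Suc i \<le> r'"
    have r': "1 \<le> r'" "\<nu> (r' - 1) \<le> \<nu> i" using c by (auto simp: skew_cells_def)
    have "\<nu> i < \<nu> (i - 1)" using i(1) n r' by (auto simp: addable_def)
    also have "\<nu> (i - 1) \<le> \<nu> (r' - 1)" using n by (intro shape_antimono[OF sh]) simp
    finally show False using r' by simp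
  qed
  ultimately show "u \<in> minimal_cells (skew_cells la \<nu>)" by (simp add: minimal_cells_def u)
qed

lemma skew_cells_remove:
  "skew_cells la \<nu> - (\<lambda>i. (Suc i, Suc (\<nu> i))) ` S = skew_cells la (add_rows \<nu> S)"
proof (rule set_eqI, clarify)
  fix r j
  show "(r, j) \<in> skew_cells la \<nu> - (\<lambda>i. (Suc i, Suc (\<nu> i))) ` S \<longleftrightarrow> (r, j) \<in> skew_cells la (add_rows \<nu> S)"
    by (cases r) (auto simp: skew_cells_def add_rows_def image_iff)
qed

lemma rpp_gf_empty: "rpp_gf {} = 1"
proof -
  have "rpps {} = {\<lambda>_. undefined}" by (auto simp: rpps_def)
  then have "{T \<in> rpps {}. (\<Sum>u\<in>{}. T u) = n} = (if n = 0 then {\<lambda>_. undefined} else {})" for n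
    by auto
  then show ?thesis unfolding rpp_gf_def by (simp add: fps_eq_iff)
qed

text \<open>Both sides satisfy the recursion over addable corners: the left side as an eigenfunction, whose terms
outside \<open>\<lambda>\<close> vanish, and the right side by inclusion-exclusion. Their difference \<open>\<Delta>\<close> is zero for all proper
enlargements by induction, which leaves \<open>\<Delta> = q ^ n * \<Delta>\<close> with \<open>n > 0\<close>.\<close>

theorem pattern_sum_rpp:
  assumes la: "is_partition la"
  shows "shape \<nu> \<Longrightarrow> \<forall>i. \<nu> i \<le> part la (Suc i) \<Longrightarrow>
    pattern_sum fls_X la \<nu> = fps_to_fls (rpp_gf (skew_cells la \<nu>)) * pattern_sum fls_X la (row_shape la)"
proof (induction "card (skew_cells la \<nu>)" arbitrary: \<nu> rule: less_induct)
  case less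
  note sh = less.prems(1) and le = less.prems(2)
  let ?q = "fls_X :: rat fls"
  let ?Z = "pattern_sum ?q la" and ?R = "\<lambda>\<nu>. fps_to_fls (rpp_gf (skew_cells la \<nu>))"
  let ?n = "card (skew_cells la \<nu>)" and ?C = "corners la \<nu>"
  define \<Delta> where "\<Delta> = (\<lambda>\<nu>. ?Z \<nu> - ?R \<nu> * ?Z (row_shape la))"
  have srt: "sorted_wrt (\<ge>) la" using la by (simp add: is_partition_def)
  have finA: "finite (addable \<nu>)" using shapeE[OF sh] addable_bound finite_subset by (metis finite_atMost)
  then have finC: "finite ?C" by (simp add: corners_def)
  have CA: "?C \<subseteq> addable \<nu>" by (auto simp: corners_def)
  show ?case
  proof (cases "?n = 0")
    case True
    then have e: "skew_cells la \<nu> = {}" using finite_skew_cells by simp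
    have "\<nu> i = row_shape la i" for i
    proof (rule ccontr)
      assume "\<nu> i \<noteq> row_shape la i"
      then have "\<nu> i < part la (Suc i)" using le[rule_format, of i] by (simp add: row_shape_def)
      moreover then have "i < length la" by (auto simp: part_def split: if_splits)
      ultimately have "(Suc i, part la (Suc i)) \<in> skew_cells la \<nu>" by (simp add: skew_cells_def)
      then show False using e by simp
    qed
    then have "\<nu> = row_shape la" by blast
    then show ?thesis using e by (simp add: rpp_gf_empty)
  next
    case False
    have add_le: "\<forall>i. add_rows \<nu> S i \<le> part la (Suc i)" if "S \<subseteq> ?C" for S
      using le that by (auto simp: add_rows_def corners_def of_bool_def Suc_le_eq)
    have "(\<Sum>S\<in>Pow (addable \<nu>). (- 1) ^ card S * ?Z (add_rows \<nu> S)) = (\<Sum>S\<in>Pow ?C. (- 1) ^ card S * ?Z (add_rows \<nu> S))"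
    proof (rule sum.mono_neutral_right)
      show "\<forall>S\<in>Pow (addable \<nu>) - Pow ?C. (- 1) ^ card S * ?Z (add_rows \<nu> S) = 0"
      proof
        fix S assume "S \<in> Pow (addable \<nu>) - Pow ?C"
        then obtain i where i: "S \<subseteq> addable \<nu>" "i \<in> S" "i \<notin> ?C" by auto
        then have "part la (Suc i) < add_rows \<nu> S i" by (auto simp: corners_def add_rows_def)
        then have "?Z (add_rows \<nu> S) = 0"
          using pattern_sum_vanishes[OF _ srt shape_add_rows[OF sh i(1)], of ?q i] by simp
        then show "(- 1) ^ card S * ?Z (add_rows \<nu> S) = 0" by simp
      qed
    qed (use finA CA in auto)
    then have "?q ^ size_of \<nu> * (\<Sum>S\<in>Pow ?C. (- 1) ^ card S * ?Z (add_rows \<nu> S)) = ?q ^ sum_list la * ?Z \<nu>"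
      using pieri_pattern_sum[of ?q \<nu> la] sh by (simp add: pieri_def)
    also have "\<dots> = ?q ^ size_of \<nu> * (?q ^ ?n * ?Z \<nu>)"
      using card_skew_cells[OF le] by (metis add.commute mult.assoc power_add)
    finally have Z: "(\<Sum>S\<in>Pow ?C. (- 1) ^ card S * ?Z (add_rows \<nu> S)) = ?q ^ ?n * ?Z \<nu>" by simp
    let ?f = "\<lambda>i. (Suc i, Suc (\<nu> i))"
    have injf: "inj_on ?f ?C" by (simp add: inj_on_def)
    have "fps_X ^ ?n * rpp_gf (skew_cells la \<nu>) = (\<Sum>S\<in>Pow (?f ` ?C). (- 1) ^ card S * rpp_gf (skew_cells la \<nu> - S))"
      using rpp_gf_recurrence[OF finite_skew_cells[of la \<nu>]] minimal_skew_cells[OF la sh le] by simp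
    also have "\<dots> = (\<Sum>S\<in>Pow ?C. (- 1) ^ card (?f ` S) * rpp_gf (skew_cells la \<nu> - ?f ` S))"
      unfolding image_Pow_surj[OF refl, symmetric]
      by (subst sum.reindex) (auto simp: inj_on_image_Pow[OF injf])
    also have "\<dots> = (\<Sum>S\<in>Pow ?C. (- 1) ^ card S * rpp_gf (skew_cells la (add_rows \<nu> S)))"
    proof (rule sum.cong[OF refl])
      fix S assume "S \<in> Pow ?C"
      then have "card (?f ` S) = card S" using injf by (intro card_image) (auto intro: inj_on_subset)
      then show "(- 1) ^ card (?f ` S) * rpp_gf (skew_cells la \<nu> - ?f ` S) = (- 1) ^ card S * rpp_gf (skew_cells la (add_rows \<nu> S))"
        by (simp only: skew_cells_remove)
    qed
    finally have "fps_to_fls (fps_X ^ ?n * rpp_gf (skew_cells la \<nu>)) =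
        fps_to_fls (\<Sum>S\<in>Pow ?C. (- 1) ^ card S * rpp_gf (skew_cells la (add_rows \<nu> S)))"
      by (rule arg_cong)
    then have R: "(\<Sum>S\<in>Pow ?C. (- 1) ^ card S * ?R (add_rows \<nu> S)) = ?q ^ ?n * ?R \<nu>"
      by (simp add: fps_to_fls_sum fls_times_fps_to_fls fps_to_fls_power)
    have "(\<Sum>S\<in>Pow ?C. (- 1) ^ card S * \<Delta> (add_rows \<nu> S)) = ?q ^ ?n * ?Z \<nu> - ?q ^ ?n * ?R \<nu> * ?Z (row_shape la)"
      unfolding \<Delta>_def Z[symmetric] R[symmetric] by (simp add: algebra_simps sum_subtractf sum_distrib_left sum_distrib_right)
    then have "(\<Sum>S\<in>Pow ?C. (- 1) ^ card S * \<Delta> (add_rows \<nu> S)) = ?q ^ ?n * \<Delta> \<nu>"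
      by (simp add: \<Delta>_def algebra_simps)
    moreover have "(\<Sum>S\<in>Pow ?C. (- 1) ^ card S * \<Delta> (add_rows \<nu> S)) = (\<Sum>S\<in>{{}}. (- 1) ^ card S * \<Delta> (add_rows \<nu> S))"
    proof (rule sum.mono_neutral_right)
      show "\<forall>S\<in>Pow ?C - {{}}. (- 1) ^ card S * \<Delta> (add_rows \<nu> S) = 0"
      proof
        fix S assume S: "S \<in> Pow ?C - {{}}"
        then have SC: "S \<subseteq> ?C" "S \<noteq> {}" by auto
        obtain i where "i \<in> S" using SC by blast
        then have "(Suc i, Suc (\<nu> i)) \<in> skew_cells la \<nu>"
          using SC by (auto simp: skew_cells_def corners_def part_def split: if_splits)
        then have "skew_cells la (add_rows \<nu> S) \<subset> skew_cells la \<nu>"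
          using \<open>i \<in> S\<close> unfolding skew_cells_remove[symmetric] by blast
        then have "card (skew_cells la (add_rows \<nu> S)) < ?n" by (rule psubset_card_mono[OF finite_skew_cells])
        then have "\<Delta> (add_rows \<nu> S) = 0"
          unfolding \<Delta>_def using less.hyps[OF _ shape_add_rows[OF sh] add_le[OF SC(1)]] SC CA by auto
        then show "(- 1) ^ card S * \<Delta> (add_rows \<nu> S) = 0" by simp
      qed
    qed (use finC in auto)
    moreover have "add_rows \<nu> {} = \<nu>" by (simp add: add_rows_def)
    ultimately have "(?q ^ ?n - 1) * \<Delta> \<nu> = 0" by (simp add: algebra_simps)
    moreover have "?q ^ ?n \<noteq> 1"
    proof
      assume "?q ^ ?n = 1"
      then have "fps_to_fls (fps_X ^ ?n :: rat fps) = fps_to_fls 1" by (simp add: fps_to_fls_power)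
      then have "(fps_X ^ ?n :: rat fps) $ 0 = 1 $ 0" by (simp only: fps_to_fls_eq_iff)
      then show False using False by simp
    qed
    ultimately show ?thesis by (simp add: \<Delta>_def)
  qed
qed

theorem theorem8p19:
  fixes la mu :: "nat list"
  assumes "is_partition la" and "is_partition mu" and "diagram mu \<subseteq> diagram la"
  shows "rpp_gf (diagram la - diagram mu) / rpp_gf (diagram la) =
    (\<Sum>D\<in>RE la mu. fps_X ^ pstar la D * (\<Prod>u\<in>B la mu D. (1 - fps_X ^ weight la u)))"
proof -
  interpret contained_partitions la mu by standard (fact assms)+
  let ?S = "\<Sum>D\<in>RE la mu. fps_X ^ pstar la D * (\<Prod>u\<in>B la mu D. (1 - fps_X ^ weight la u)) :: rat fps"
  let ?Z = "pattern_sum (fls_X :: rat fls) la"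
  have skew: "diagram la - diagram mu = skew_cells la \<mu>"
    by (auto simp: diagram_def skew_cells_def row_shape_def part_def split: if_splits)
  have straight: "diagram la = skew_cells la (\<lambda>_. 0)"
    by (auto simp: diagram_def skew_cells_def part_def)
  have m: "?Z \<mu> = fps_to_fls (rpp_gf (diagram la - diagram mu)) * ?Z (row_shape la)"
    unfolding skew using mu_le by (intro pattern_sum_rpp[OF la shape_row_shape[OF mu]]) blast
  have "1 = fps_to_fls (rpp_gf (diagram la)) * ?Z (row_shape la)"
    unfolding straight using pattern_sum_rpp[OF la shape_zero] pattern_sum_zero[of "fls_X :: rat fls" la] by simp
  then have nz: "rpp_gf (diagram la) \<noteq> 0"
    and z: "?Z (row_shape la) * fps_to_fls (rpp_gf (diagram la)) = 1" by (auto simp: mult.commute)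
  have "fps_to_fls (?S * rpp_gf (diagram la)) = ?Z \<mu> * fps_to_fls (rpp_gf (diagram la))"
    unfolding fls_times_fps_to_fls RE_sum by simp
  also have "\<dots> = fps_to_fls (rpp_gf (diagram la - diagram mu))"
    unfolding m mult.assoc z by simp
  finally have eq: "rpp_gf (diagram la - diagram mu) = ?S * rpp_gf (diagram la)" by simp
  show ?thesis unfolding eq by (rule nonzero_mult_div_cancel_right[OF nz])
qed

end
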